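(* Let $\Bbbk$ be an algebraically closed field of characteristic zero, $N > 1$ an odd integer, $q \in \Bbbk$ a primitive $N$-th root of unity, and $\alpha, \beta \in \Bbbk$. In $\overline{U}_q(\mathfrak{sl}_2)$ put $\tilde F = (q-q^{-1})KF$, $u_{\alpha,\beta} = E + \alpha\tilde F + \beta K$, and let $A_{\alpha,\beta} = \langle u_{\alpha,\beta} \rangle$ be the unital subalgebra generated by $u_{\alpha,\beta}$. Then the minimal polynomial of $u_{\alpha,\beta}$ is $$\phi_{\alpha,\beta}(X) = (X - \beta)\prod_{k=1}^{(N-1)/2}\left( X^2 - \beta(q^{2k} + q^{-2k})X + \beta^2 + \frac{(q^{2k} - q^{-2k})^2}{1 - q^2}\alpha \right),$$ and therefore $A_{\alpha,\beta} \cong \Bbbk[X]/(\phi_{\alpha,\beta}(X))$ as algebras. The algebra $A_{\alpha,\beta}$ is semisimple if and only if $D(\alpha,\beta) \ne 0$, where $$D(\alpha,\beta) = \prod_{k=0}^{N-1} D_k(\alpha,\beta), \qquad D_k(\alpha,\beta) = \beta^2 - \frac{(q^k + q^{-k})^2}{1-q^2}\alpha.$$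
   Context: $\overline{U}_q(\mathfrak{sl}_2)$ is the algebra generated by $K, E, F$ subject to $K^N = 1$, $KE = q^2 EK$, $KF = q^{-2}FK$, $E^N = F^N = 0$, $EF - FE = (K - K^{-1})/(q - q^{-1})$. *)

theory Defs
  imports
    "HOL-Algebra.Subrings"
    "HOL-Algebra.Module"
    "HOL-Library.Poly_Mapping"
    "HOL-Library.FuncSet"
    "HOL-Computational_Algebra.Polynomial"
begin

section \<open>Associative unital algebras over a field\<close>

text \<open>
  The ground field is a type \<open>'k\<close> of class \<open>field\<close>. A \<open>'k\<close>-algebra with elements in \<open>'a\<close>
  is a record of type \<open>('k, 'a) module\<close>: a (possibly noncommutative) ring together with the
  scalar multiplication \<open>\<odot>\<close>.
\<close>

definition type_algebra :: "('k \<Rightarrow> 'a \<Rightarrow> 'a) \<Rightarrow> ('k, 'a::ring_1) module" where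
  "type_algebra s = \<lparr> carrier = UNIV, monoid.mult = (*), one = 1, ring.zero = 0, add = (+), module.smult = s \<rparr>"

text \<open>The scalar multiplication of the quotient sends \<open>c\<close> and \<open>I +> x\<close> to \<open>I +> c \<odot> x\<close>,
  written as a union over representatives as in \<^const>\<open>rcoset_mult\<close>.\<close>

definition quot_algebra :: "('k, 'a) module \<Rightarrow> 'a set \<Rightarrow> ('k, 'a set) module" where
  "quot_algebra A I =
     ring.extend (A Quot I) (module.fields (\<lambda>c X. \<Union>x\<in>X. I +>\<^bsub>A\<^esub> (c \<odot>\<^bsub>A\<^esub> x)))"

definition unital_subalgebra :: "'a set \<Rightarrow> ('k, 'a) module \<Rightarrow> bool" where
  "unital_subalgebra B A \<longleftrightarrow> subring B A \<and> (\<forall>c. \<forall>x\<in>B. c \<odot>\<^bsub>A\<^esub> x \<in> B)"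

definition generated_subalgebra :: "('k, 'a) module \<Rightarrow> 'a set \<Rightarrow> ('k, 'a) module" where
  "generated_subalgebra A S = A\<lparr>carrier := \<Inter>{B. unital_subalgebra B A \<and> S \<subseteq> B}\<rparr>"

definition algebra_iso :: "('k, 'a) module \<Rightarrow> ('k, 'b) module \<Rightarrow> ('a \<Rightarrow> 'b) set" where
  "algebra_iso A B =
     {h \<in> ring_iso A B. \<forall>c. \<forall>x\<in>carrier A. h (c \<odot>\<^bsub>A\<^esub> x) = c \<odot>\<^bsub>B\<^esub> h x}"

definition algebra_isomorphic :: "('k, 'a) module \<Rightarrow> ('k, 'b) module \<Rightarrow> bool" where
  "algebra_isomorphic A B \<longleftrightarrow> algebra_iso A B \<noteq> {}"

definition eval_poly :: "('k::field, 'a) module \<Rightarrow> 'k poly \<Rightarrow> 'a \<Rightarrow> 'a" where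
  "eval_poly A p x = (\<Oplus>\<^bsub>A\<^esub>i\<in>{..Polynomial.degree p}. Polynomial.coeff p i \<odot>\<^bsub>A\<^esub> (x [^]\<^bsub>A\<^esub> i))"

definition is_minimal_poly :: "('k::field, 'a) module \<Rightarrow> 'a \<Rightarrow> 'k poly \<Rightarrow> bool" where
  "is_minimal_poly A x p \<longleftrightarrow>
     lead_coeff p = 1 \<and> eval_poly A p x = \<zero>\<^bsub>A\<^esub> \<and>
     (\<forall>r. r \<noteq> 0 \<and> eval_poly A r x = \<zero>\<^bsub>A\<^esub> \<longrightarrow> Polynomial.degree p \<le> Polynomial.degree r)"


section \<open>Semisimplicity\<close>

text \<open>
  An algebra is semisimple if its left regular module is a direct sum of simple modules, that is,
  of minimal left ideals. Left ideals need not be required to be closed under \<open>\<odot>\<close>, because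
  \<open>c \<odot> x = (c \<odot> \<one>) \<otimes> x\<close>. The family may be taken finite, because \<open>\<one>\<close> lies in a
  finite subsum. \<open>Pi\<^sub>E\<close> makes the components of a decomposition unique as a function.
\<close>

definition left_ideal :: "'a set \<Rightarrow> ('a, 'm) ring_scheme \<Rightarrow> bool" where
  "left_ideal L A \<longleftrightarrow> additive_subgroup L A \<and> (\<forall>a\<in>carrier A. \<forall>x\<in>L. a \<otimes>\<^bsub>A\<^esub> x \<in> L)"

definition simple_left_ideal :: "'a set \<Rightarrow> ('a, 'm) ring_scheme \<Rightarrow> bool" where
  "simple_left_ideal L A \<longleftrightarrow> left_ideal L A \<and> L \<noteq> {\<zero>\<^bsub>A\<^esub>} \<and>
     (\<forall>J. left_ideal J A \<and> J \<subseteq> L \<longrightarrow> J = {\<zero>\<^bsub>A\<^esub>} \<or> J = L)"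

definition semisimple_algebra :: "('a, 'm) ring_scheme \<Rightarrow> bool" where
  "semisimple_algebra A \<longleftrightarrow>
     (\<exists>S. finite S \<and> (\<forall>L\<in>S. simple_left_ideal L A) \<and>
        (\<forall>x\<in>carrier A. \<exists>!f. f \<in> (\<Pi>\<^sub>E L\<in>S. L) \<and> x = (\<Oplus>\<^bsub>A\<^esub>L\<in>S. f L)))"


section \<open>Free algebras and polynomial algebras\<close>

datatype 'a free_monoid = Word "'a list"

instantiation free_monoid :: (type) monoid_add
begin

definition zero_free_monoid :: "'a free_monoid" where
  "0 = Word []"

fun plus_free_monoid :: "'a free_monoid \<Rightarrow> 'a free_monoid \<Rightarrow> 'a free_monoid" where
  "Word xs + Word ys = Word (xs @ ys)"

instance
proof
  fix a b c :: "'a free_monoid"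
  show "a + b + c = a + (b + c)"
    by (cases a; cases b; cases c) simp
  show "0 + a = a" "a + 0 = a"
    by (cases a; simp add: zero_free_monoid_def)+
qed

end

text \<open>
  The free algebra on \<open>'g\<close> is the monoid algebra of the free monoid; its multiplication is the
  convolution product of \<^theory>\<open>HOL-Library.Poly_Mapping\<close>.
\<close>

type_synonym ('k, 'g) free_alg = "'g free_monoid \<Rightarrow>\<^sub>0 'k"

definition free_gen :: "'g \<Rightarrow> ('k::field, 'g) free_alg" where
  "free_gen g = Poly_Mapping.single (Word [g]) 1"

definition free_const :: "'k::field \<Rightarrow> ('k, 'g) free_alg" where
  "free_const c = Poly_Mapping.single 0 c"

definition free_algebra :: "('k::field, ('k, 'g) free_alg) module" where
  "free_algebra = type_algebra (\<lambda>c x. free_const c * x)"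

definition poly_algebra :: "('k::field, 'k poly) module" where
  "poly_algebra = type_algebra Polynomial.smult"


section \<open>The small quantum group\<close>

datatype uq_gen = Gen_K | Gen_E | Gen_F

text \<open>Since \<open>K ^ N = 1\<close>, the inverse of \<open>K\<close> is \<open>K ^ (N - 1)\<close>.\<close>

definition uq_relators :: "nat \<Rightarrow> 'k::field \<Rightarrow> ('k, uq_gen) free_alg set" where
  "uq_relators N q =
    (let K = free_gen Gen_K; E = free_gen Gen_E; F = free_gen Gen_F in
     {K ^ N - 1,
      K * E - free_const (q\<^sup>2) * (E * K),
      K * F - free_const (1 / q\<^sup>2) * (F * K),
      E ^ N,
      F ^ N,
      E * F - F * E - free_const (1 / (q - 1 / q)) * (K - K ^ (N - 1))})"

text \<open>In \<^theory>\<open>HOL-Algebra.Ideal\<close>, ideals, and hence \<^const>\<open>genideal\<close>, are two-sided.\<close>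

definition uq_ideal :: "nat \<Rightarrow> 'k::field \<Rightarrow> ('k, uq_gen) free_alg set" where
  "uq_ideal N q = genideal free_algebra (uq_relators N q)"

definition uq_sl2 :: "nat \<Rightarrow> 'k::field \<Rightarrow> ('k, ('k, uq_gen) free_alg set) module" where
  "uq_sl2 N q = quot_algebra free_algebra (uq_ideal N q)"

definition uq_elem :: "nat \<Rightarrow> 'k::field \<Rightarrow> uq_gen \<Rightarrow> ('k, uq_gen) free_alg set" where
  "uq_elem N q g = uq_ideal N q +>\<^bsub>free_algebra\<^esub> free_gen g"

definition uq_Ftilde :: "nat \<Rightarrow> 'k::field \<Rightarrow> ('k, uq_gen) free_alg set" where
  "uq_Ftilde N q =
     (q - 1 / q) \<odot>\<^bsub>uq_sl2 N q\<^esub> (uq_elem N q Gen_K \<otimes>\<^bsub>uq_sl2 N q\<^esub> uq_elem N q Gen_F)"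

definition uq_u :: "nat \<Rightarrow> 'k::field \<Rightarrow> 'k \<Rightarrow> 'k \<Rightarrow> ('k, uq_gen) free_alg set" where
  "uq_u N q \<alpha> \<beta> =
     uq_elem N q Gen_E \<oplus>\<^bsub>uq_sl2 N q\<^esub> \<alpha> \<odot>\<^bsub>uq_sl2 N q\<^esub> uq_Ftilde N q
       \<oplus>\<^bsub>uq_sl2 N q\<^esub> \<beta> \<odot>\<^bsub>uq_sl2 N q\<^esub> uq_elem N q Gen_K"

definition uq_A :: "nat \<Rightarrow> 'k::field \<Rightarrow> 'k \<Rightarrow> 'k \<Rightarrow> ('k, ('k, uq_gen) free_alg set) module" where
  "uq_A N q \<alpha> \<beta> = generated_subalgebra (uq_sl2 N q) {uq_u N q \<alpha> \<beta>}"

definition primitive_root_of_unity :: "nat \<Rightarrow> 'k::field \<Rightarrow> bool" where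
  "primitive_root_of_unity N q \<longleftrightarrow> q ^ N = 1 \<and> (\<forall>k. 0 < k \<and> k < N \<longrightarrow> q ^ k \<noteq> 1)"

definition phi_poly :: "nat \<Rightarrow> 'k::field \<Rightarrow> 'k \<Rightarrow> 'k \<Rightarrow> 'k poly" where
  "phi_poly N q \<alpha> \<beta> =
     [:- \<beta>, 1:] *
     (\<Prod>k = 1..(N - 1) div 2.
        [: \<beta>\<^sup>2 + (q ^ (2 * k) - 1 / q ^ (2 * k))\<^sup>2 / (1 - q\<^sup>2) * \<alpha>,
           - \<beta> * (q ^ (2 * k) + 1 / q ^ (2 * k)),
           1 :])"

definition D_factor :: "'k::field \<Rightarrow> nat \<Rightarrow> 'k \<Rightarrow> 'k \<Rightarrow> 'k" where
  "D_factor q k \<alpha> \<beta> = \<beta>\<^sup>2 - (q ^ k + 1 / q ^ k)\<^sup>2 / (1 - q\<^sup>2) * \<alpha>"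

definition D_total :: "nat \<Rightarrow> 'k::field \<Rightarrow> 'k \<Rightarrow> 'k \<Rightarrow> 'k" where
  "D_total N q \<alpha> \<beta> = (\<Prod>k = 0..N - 1. D_factor q k \<alpha> \<beta>)"

end

theory Submission
  imports Defs
begin

text \<open>
  Put \<open>t = q\<^sup>2\<close> and choose \<open>x, y\<close> with \<open>x + y = \<beta>\<close> and \<open>x y = \<gamma> = \<alpha> / (1 - t)\<close>.
  Then \<open>u = P + R\<close> with \<open>P = E + x K\<close> and \<open>R = \<alpha> F~ + y K\<close>, and these satisfy the
  \<open>t\<close>-oscillator relation \<open>R P = t P R + (1 - t) \<gamma>\<close>. Hence the continuous \<open>t\<close>-Hermite polynomial
  of degree \<open>N\<close>, evaluated at \<open>u\<close>, is the sum of the \<open>t\<close>-binomial multiples of \<open>P ^ k R ^ (N - k)\<close>,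
  of which only \<open>P ^ N + R ^ N\<close> survives at a primitive \<open>N\<close>-th root of unity; by the
  \<open>t\<close>-binomial theorem this is \<open>x ^ N + y ^ N\<close>. The same identity for commuting \<open>p\<close> and
  \<open>\<gamma> / p\<close> shows that the Hermite polynomial minus \<open>x ^ N + y ^ N\<close> has the roots
  \<open>x t ^ k + y / t ^ k\<close>, so it is \<open>\<phi>\<close>. No polynomial of smaller degree kills \<open>u\<close>, because \<open>u\<close> acts
  on a baby Verma module as a raising operator plus terms that do not raise. Finally \<open>\<phi>\<close> is
  separable unless \<open>x = y t ^ m\<close> for some \<open>m\<close>, and \<open>D\<close> is the product of the
  \<open>(x - y t ^ m) (x - y / t ^ m)\<close>.
\<close>

section \<open>q-Hermite polynomials\<close>

text \<open>Pascal's rule serves as the definition because the quotient of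
  \<open>t\<close>-factorials would divide by zero at a root of unity.\<close>

fun qbinom :: "'k::comm_ring_1 \<Rightarrow> nat \<Rightarrow> nat \<Rightarrow> 'k" where
  "qbinom t n 0 = 1"
| "qbinom t 0 (Suc k) = 0"
| "qbinom t (Suc n) (Suc k) = qbinom t n k + t ^ Suc k * qbinom t n (Suc k)"

lemma qbinom_eq_0: "n < k \<Longrightarrow> qbinom t n k = 0"
  by (induction t n k rule: qbinom.induct) auto

lemma qbinom_self: "qbinom t n n = 1"
  by (induction n) (auto simp: qbinom_eq_0)

text \<open>The two identities prove each other: the ratio identity at \<open>n\<close> and Pascal's
  rule give absorption at \<open>n\<close>, and absorption at \<open>m\<close> gives the ratio
  identity at \<open>Suc m\<close>. The factor \<open>t ^ k\<close> in the ratio identity avoids the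
  truncated exponent \<open>n - k\<close>.\<close>

lemma qbinom_ratio_absorb:
  "t ^ k * (1 - t ^ Suc k) * qbinom t n (Suc k) = (t ^ k - t ^ n) * qbinom t n k \<and>
   (1 - t ^ Suc k) * qbinom t (Suc n) (Suc k) = (1 - t ^ Suc n) * qbinom t n k"
proof -
  have absorb: "(1 - t ^ Suc k) * qbinom t (Suc n) (Suc k) = (1 - t ^ Suc n) * qbinom t n k"
    if "t ^ k * (1 - t ^ Suc k) * qbinom t n (Suc k) = (t ^ k - t ^ n) * qbinom t n k" for n k
  proof -
    have "(1 - t ^ Suc k) * qbinom t (Suc n) (Suc k)
        = (1 - t ^ Suc k) * qbinom t n k + t * (t ^ k * (1 - t ^ Suc k) * qbinom t n (Suc k))"
      by (simp add: algebra_simps)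
    then show ?thesis
      unfolding that by (simp add: algebra_simps)
  qed
  have "t ^ k * (1 - t ^ Suc k) * qbinom t n (Suc k) = (t ^ k - t ^ n) * qbinom t n k"
  proof (induction n arbitrary: k)
    case 0
    then show ?case
      by (cases k) auto
  next
    case (Suc m)
    note IH = Suc
    have "t ^ k * (1 - t ^ Suc k) * qbinom t (Suc m) (Suc k) = t ^ k * (1 - t ^ Suc m) * qbinom t m k"
      using absorb[OF IH] by (simp add: mult.assoc)
    also have "\<dots> = (t ^ k - t ^ Suc m) * qbinom t (Suc m) k"
    proof (cases k)
      case (Suc j)
      have "(t ^ k - t ^ Suc m) * qbinom t (Suc m) k
          = t * ((t ^ j - t ^ m) * qbinom t m j) + t ^ k * (t ^ k - t ^ Suc m) * qbinom t m k"
        by (simp add: Suc algebra_simps)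
      also have "\<dots> = t ^ k * (1 - t ^ Suc m) * qbinom t m k"
        unfolding IH[of j, symmetric] by (simp add: Suc algebra_simps)
      finally show ?thesis
        by simp
    qed auto
    finally show ?case .
  qed
  with absorb show ?thesis
    by blast
qed

lemma qbinom_absorb: "(1 - t ^ Suc k) * qbinom t (Suc n) (Suc k) = (1 - t ^ Suc n) * qbinom t n k"
  using qbinom_ratio_absorb by blast

text \<open>In the absorption identity the right side carries the factor
  \<open>1 - t ^ N = 0\<close>, while the factor \<open>1 - t ^ k\<close> on the left is
  nonzero.\<close>

lemma qbinom_root_of_unity:
  fixes t :: "'k::field"
  assumes "primitive_root_of_unity N t" and "0 < k" and "k < N"
  shows "qbinom t N k = 0"
proof -
  obtain n j where "N = Suc n" "k = Suc j"
    using assms by (metis gr0_conv_Suc less_trans)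
  with qbinom_absorb[of t j n] assms show ?thesis
    unfolding primitive_root_of_unity_def by auto
qed

text \<open>A rescaling of the continuous \<open>t\<close>-Hermite polynomials: at
  \<open>p + \<gamma> / p\<close> their values are the Rogers-Szego polynomials of \<open>p\<close> and \<open>\<gamma> / p\<close>.\<close>

fun qhermite :: "'k::comm_ring_1 \<Rightarrow> 'k \<Rightarrow> nat \<Rightarrow> 'k poly" where
  "qhermite t \<gamma> 0 = 1"
| "qhermite t \<gamma> (Suc 0) = [:0, 1:]"
| "qhermite t \<gamma> (Suc (Suc n)) =
     [:0, 1:] * qhermite t \<gamma> (Suc n) - smult (\<gamma> * (1 - t ^ Suc n)) (qhermite t \<gamma> n)"

lemma qhermite_0: "qhermite t 0 n = monom 1 n"
  by (induction t "0::'a" n rule: qhermite.induct) (auto simp: monom_Suc one_pCons monom_0)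

section \<open>Polynomial evaluation and Rogers-Szego sums in a noncommutative ring\<close>

text \<open>The structure map of an algebra whose ring is a type. It is instantiated with the field
  itself, with constant polynomials and with the constants of the free algebra.\<close>

locale central_scalars =
  fixes sc :: "'k::field \<Rightarrow> 'a::ring_1"
  assumes sc_1: "sc 1 = 1"
    and sc_add: "sc (a + b) = sc a + sc b"
    and sc_mult: "sc (a * b) = sc a * sc b"
    and sc_commute: "x * sc a = sc a * x"
begin

lemma sc_0: "sc 0 = 0"
  using sc_add[of 0 0] by simp

lemma sc_minus: "sc (- a) = - sc a"
  using sc_add[of a "- a"] by (simp add: sc_0 add_eq_0_iff)

lemma sc_diff: "sc (a - b) = sc a - sc b"
  using sc_add[of a "- b"] by (simp add: sc_minus)

lemma sc_left_commute: "x * (sc a * y) = sc a * (x * y)"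
  by (metis mult.assoc sc_commute)

text \<open>The counterpart of \<open>eval_poly\<close> in type-class arithmetic;
  \<open>eval_poly_proj\<close> links the two.\<close>

definition ev :: "'k poly \<Rightarrow> 'a \<Rightarrow> 'a" where
  "ev p g = (\<Sum>i\<le>degree p. sc (coeff p i) * g ^ i)"

lemma ev_altdef: "degree p \<le> n \<Longrightarrow> ev p g = (\<Sum>i\<le>n. sc (coeff p i) * g ^ i)"
  unfolding ev_def by (rule sum.mono_neutral_left) (auto simp: coeff_eq_0 sc_0)

lemma ev_0: "ev 0 g = 0"
  by (simp add: ev_def sc_0)

lemma ev_1: "ev 1 g = 1"
  by (simp add: ev_def sc_1)

lemma ev_pCons: "ev (pCons a p) g = sc a + g * ev p g"
proof -
  have "ev (pCons a p) g = (\<Sum>i\<le>Suc (degree p). sc (coeff (pCons a p) i) * g ^ i)"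
    by (rule ev_altdef) (simp add: degree_pCons_le)
  also have "\<dots> = sc a + g * ev p g"
    by (subst sum.atMost_Suc_shift) (simp add: ev_def sum_distrib_left sc_left_commute)
  finally show ?thesis .
qed

lemma ev_add: "ev (p + r) g = ev p g + ev r g"
proof -
  let ?n = "max (degree p) (degree r)"
  have "ev (p + r) g = (\<Sum>i\<le>?n. sc (coeff (p + r) i) * g ^ i)"
    by (rule ev_altdef) (rule degree_add_le_max)
  then show ?thesis
    by (simp add: ev_altdef[of p ?n] ev_altdef[of r ?n] sc_add distrib_right sum.distrib)
qed

lemma ev_smult: "ev (smult c p) g = sc c * ev p g"
  by (induction p) (simp_all add: ev_0 ev_pCons sc_mult distrib_left sc_left_commute)

lemma ev_mult: "ev (p * r) g = ev p g * ev r g"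
  by (induction p) (simp_all add: ev_0 ev_add ev_pCons ev_smult sc_0 distrib_right mult.assoc)

lemma ev_diff: "ev (p - r) g = ev p g - ev r g"
  using ev_add[of "p - r" r g] by simp

lemma ev_monom: "ev (monom c n) g = sc c * g ^ n"
  by (induction n) (simp_all add: monom_0 monom_Suc ev_pCons ev_0 sc_0 sc_left_commute)

text \<open>Homogeneous Rogers-Szego polynomials in normally ordered form: every \<open>P\<close>
  stands to the left of every \<open>Q\<close>.\<close>

definition rogers_szego :: "'k \<Rightarrow> 'a \<Rightarrow> 'a \<Rightarrow> nat \<Rightarrow> 'a" where
  "rogers_szego t P Q n = (\<Sum>k\<le>n. sc (qbinom t n k) * (P ^ k * Q ^ (n - k)))"

text \<open>A formal identity without any commutation rule for \<open>P\<close> and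
  \<open>Q\<close>. It writes the failure of the Hermite recurrence as a combination of the failures
  of \<open>Q\<close> to commute with powers of \<open>P\<close> in the oscillator manner.\<close>

lemma rogers_szego_rec:
  "(P + Q) * rogers_szego t P Q (Suc n) - rogers_szego t P Q (Suc (Suc n))
     - sc (\<gamma> * (1 - t ^ Suc n)) * rogers_szego t P Q n =
   (\<Sum>k\<le>n. sc (qbinom t (Suc n) (Suc k)) *
     ((Q * P ^ Suc k - sc (t ^ Suc k) * (P ^ Suc k * Q) - sc (\<gamma> * (1 - t ^ Suc k)) * P ^ k) * Q ^ (n - k)))"
proof -
  \<comment> \<open>Multiplying by \<open>P + Q\<close> yields \<open>SP\<close> and
    \<open>Q ^ Suc (Suc n) + SQ\<close>; Pascal's rule splits the sum of index
    \<open>Suc (Suc n)\<close> into \<open>Q ^ Suc (Suc n) + SP + ST\<close>; absorption turns the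
    last term into \<open>SG\<close>. What is left is \<open>SQ - ST - SG\<close>.\<close>
  define SP where "SP = (\<Sum>k\<le>Suc n. sc (qbinom t (Suc n) k) * (P ^ Suc k * Q ^ (Suc n - k)))"
  define SQ where "SQ = (\<Sum>k\<le>n. sc (qbinom t (Suc n) (Suc k)) * (Q * P ^ Suc k * Q ^ (n - k)))"
  define ST where "ST = (\<Sum>k\<le>n. sc (qbinom t (Suc n) (Suc k)) * (sc (t ^ Suc k) * (P ^ Suc k * Q) * Q ^ (n - k)))"
  define SG where "SG = (\<Sum>k\<le>n. sc (qbinom t (Suc n) (Suc k)) * (sc (\<gamma> * (1 - t ^ Suc k)) * P ^ k * Q ^ (n - k)))"
  have P: "P * rogers_szego t P Q (Suc n) = SP"
    unfolding SP_def rogers_szego_def sum_distrib_left by (simp only: sc_left_commute mult.assoc power_Suc)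
  have Q: "Q * rogers_szego t P Q (Suc n) = Q ^ Suc (Suc n) + SQ"
    unfolding SQ_def rogers_szego_def sum.atMost_Suc_shift
    by (simp add: sum_distrib_left sc_left_commute mult.assoc distrib_left sc_1 del: qbinom.simps(3))
  have "rogers_szego t P Q (Suc (Suc n)) =
      Q ^ Suc (Suc n) + (\<Sum>k\<le>Suc n. sc (qbinom t (Suc (Suc n)) (Suc k)) * (P ^ Suc k * Q ^ (Suc n - k)))"
    unfolding rogers_szego_def sum.atMost_Suc_shift[of _ "Suc n"]
    by (simp only: sc_1 qbinom.simps(1) power_0 mult_1_left diff_zero diff_Suc_Suc)
  also have "(\<Sum>k\<le>Suc n. sc (qbinom t (Suc (Suc n)) (Suc k)) * (P ^ Suc k * Q ^ (Suc n - k))) =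
      SP + (\<Sum>k\<le>Suc n. sc (t ^ Suc k * qbinom t (Suc n) (Suc k)) * (P ^ Suc k * Q ^ (Suc n - k)))"
    unfolding qbinom.simps(3)[of t "Suc n"] SP_def by (simp only: sc_add distrib_right sum.distrib)
  also have "(\<Sum>k\<le>Suc n. sc (t ^ Suc k * qbinom t (Suc n) (Suc k)) * (P ^ Suc k * Q ^ (Suc n - k))) =
      (\<Sum>k\<le>n. sc (t ^ Suc k * qbinom t (Suc n) (Suc k)) * (P ^ Suc k * Q ^ (Suc n - k)))"
    using qbinom_eq_0[of "Suc n" "Suc (Suc n)" t] by (simp add: sc_0 del: qbinom.simps(3))
  also have "\<dots> = ST"
    unfolding ST_def
  proof (rule sum.cong[OF refl])
    fix k
    assume "k \<in> {..n}"
    then have "Suc n - k = Suc (n - k)"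
      by auto
    then show "sc (t ^ Suc k * qbinom t (Suc n) (Suc k)) * (P ^ Suc k * Q ^ (Suc n - k)) =
        sc (qbinom t (Suc n) (Suc k)) * (sc (t ^ Suc k) * (P ^ Suc k * Q) * Q ^ (n - k))"
      by (simp only: power_Suc[of Q] mult.commute[of "t ^ Suc k"] sc_mult mult.assoc)
  qed
  finally have H2: "rogers_szego t P Q (Suc (Suc n)) = Q ^ Suc (Suc n) + (SP + ST)" .
  have G: "sc (\<gamma> * (1 - t ^ Suc n)) * rogers_szego t P Q n = SG"
    unfolding SG_def rogers_szego_def sum_distrib_left
  proof (rule sum.cong[OF refl])
    fix k
    have "\<gamma> * (1 - t ^ Suc n) * qbinom t n k = qbinom t (Suc n) (Suc k) * (\<gamma> * (1 - t ^ Suc k))"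
      by (metis qbinom_absorb mult.assoc mult.commute)
    then show "sc (\<gamma> * (1 - t ^ Suc n)) * (sc (qbinom t n k) * (P ^ k * Q ^ (n - k))) =
        sc (qbinom t (Suc n) (Suc k)) * (sc (\<gamma> * (1 - t ^ Suc k)) * P ^ k * Q ^ (n - k))"
      by (metis mult.assoc sc_mult)
  qed
  have "(\<Sum>k\<le>n. sc (qbinom t (Suc n) (Suc k)) * ((Q * P ^ Suc k - sc (t ^ Suc k) * (P ^ Suc k * Q)
      - sc (\<gamma> * (1 - t ^ Suc k)) * P ^ k) * Q ^ (n - k))) = SQ - ST - SG"
    unfolding SQ_def ST_def SG_def by (simp only: sum_subtractf left_diff_distrib right_diff_distrib)
  then show ?thesis
    unfolding distrib_right P Q H2 G by simp
qed

end

section \<open>Identities modulo a two-sided ideal\<close>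

text \<open>Relations are stated as membership in a two-sided ideal of a type-class ring, so that
  ring simplification stays available; the passage to quotient records comes later.\<close>

locale central_quotient = central_scalars +
  fixes I :: "'b set"
  assumes I_0: "0 \<in> I"
    and I_add: "a \<in> I \<Longrightarrow> b \<in> I \<Longrightarrow> a + b \<in> I"
    and I_left: "a \<in> I \<Longrightarrow> r * a \<in> I"
    and I_right: "a \<in> I \<Longrightarrow> a * r \<in> I"
begin

lemma I_minus: "a \<in> I \<Longrightarrow> - a \<in> I"
  using I_left[of a "-1"] by simp

lemma I_diff: "a \<in> I \<Longrightarrow> b \<in> I \<Longrightarrow> a - b \<in> I"
  using I_add[of a "- b"] I_minus[of b] by simp

lemma I_sum: "(\<And>i. i \<in> S \<Longrightarrow> f i \<in> I) \<Longrightarrow> sum f S \<in> I"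
  by (induction S rule: infinite_finite_induct) (auto simp: I_0 I_add)

text \<open>For the induction, the relation for \<open>P ^ Suc k\<close> is multiplied by
  \<open>P\<close> on the right and the base relation by \<open>t ^ Suc k\<close> and
  \<open>P ^ Suc k\<close> on the left. The constants add up because
  \<open>(1 - t ^ Suc k) + t ^ Suc k * (1 - t) = 1 - t ^ Suc (Suc k)\<close>.\<close>

lemma qcommute_power:
  assumes "Q * P - sc t * (P * Q) - sc (\<gamma> * (1 - t)) \<in> I"
  shows "Q * P ^ Suc k - sc (t ^ Suc k) * (P ^ Suc k * Q) - sc (\<gamma> * (1 - t ^ Suc k)) * P ^ k \<in> I"
proof (induction k)
  case 0
  then show ?case
    using assms by simp
next
  case (Suc k)
  let ?X = "Q * P ^ Suc k - sc (t ^ Suc k) * (P ^ Suc k * Q) - sc (\<gamma> * (1 - t ^ Suc k)) * P ^ k"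
  let ?Y = "Q * P - sc t * (P * Q) - sc (\<gamma> * (1 - t))"
  have "?X * P + sc (t ^ Suc k) * (P ^ Suc k * ?Y) \<in> I"
    using Suc assms by (intro I_add I_left I_right)
  also have "?X * P + sc (t ^ Suc k) * (P ^ Suc k * ?Y) =
      Q * P ^ Suc (Suc k) - sc (t ^ Suc (Suc k)) * (P ^ Suc (Suc k) * Q)
        - (sc (\<gamma> * (1 - t ^ Suc k)) + sc (t ^ Suc k) * sc (\<gamma> * (1 - t))) * P ^ Suc k"
  proof -
    define T C D R where "T = sc (t ^ Suc k)" and "C = sc (\<gamma> * (1 - t ^ Suc k))"
      and "D = sc (\<gamma> * (1 - t))" and "R = P ^ Suc k"
    have p: "P ^ k * P = R" "P ^ Suc (Suc k) = R * P"
      by (simp_all only: R_def power_Suc2)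
    have "R * (sc t * (P * Q)) = sc t * (R * (P * Q))" "R * D = D * R"
      unfolding D_def by (rule sc_left_commute, rule sc_commute)
    moreover have "sc (t ^ Suc (Suc k)) = T * sc t"
      unfolding T_def by (simp add: sc_mult[symmetric] mult.commute)
    ultimately show ?thesis
      unfolding p(2) T_def[symmetric] C_def[symmetric] D_def[symmetric] R_def[symmetric]
      by (simp add: left_diff_distrib right_diff_distrib distrib_right mult.assoc p(1))
  qed
  also have "sc (\<gamma> * (1 - t ^ Suc k)) + sc (t ^ Suc k) * sc (\<gamma> * (1 - t)) = sc (\<gamma> * (1 - t ^ Suc (Suc k)))"
    unfolding sc_mult[symmetric] sc_add[symmetric] by (simp add: algebra_simps)
  finally show ?case .
qed

text \<open>Modulo \<open>I\<close> both sequences satisfy the same three-term recurrence, and they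
  agree for \<open>n = 0\<close> and \<open>n = 1\<close>.\<close>

lemma ev_qhermite:
  assumes "Q * P - sc t * (P * Q) - sc (\<gamma> * (1 - t)) \<in> I"
  shows "ev (qhermite t \<gamma> n) (P + Q) - rogers_szego t P Q n \<in> I"
proof (induction n rule: induct_nat_012)
  case 0
  then show ?case
    by (simp add: ev_1 rogers_szego_def sc_1 I_0)
next
  case 1
  then show ?case
    by (simp add: ev_pCons ev_0 rogers_szego_def sc_1 sc_0 I_0 add.commute)
next
  case (ge2 n)
  let ?d = "\<lambda>n. ev (qhermite t \<gamma> n) (P + Q) - rogers_szego t P Q n"
  let ?c = "sc (\<gamma> * (1 - t ^ Suc n))"
  have "(P + Q) * rogers_szego t P Q (Suc n) - rogers_szego t P Q (Suc (Suc n))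
      - ?c * rogers_szego t P Q n \<in> I"
    unfolding rogers_szego_rec by (intro I_sum I_left I_right qcommute_power assms)
  then have "(P + Q) * ?d (Suc n) - ?c * ?d n + ((P + Q) * rogers_szego t P Q (Suc n)
      - rogers_szego t P Q (Suc (Suc n)) - ?c * rogers_szego t P Q n) \<in> I"
    using ge2 by (intro I_add[of _ "_ - _ * rogers_szego t P Q n"] I_diff[of "(P + Q) * _"] I_left)
  also have "(P + Q) * ?d (Suc n) - ?c * ?d n + ((P + Q) * rogers_szego t P Q (Suc n)
      - rogers_szego t P Q (Suc (Suc n)) - ?c * rogers_szego t P Q n) = ?d (Suc (Suc n))"
    by (simp add: ev_diff ev_mult ev_smult ev_pCons ev_0 sc_0 sc_1 right_diff_distrib
        del: power_Suc)
  finally show ?case .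
qed

lemma rogers_szego_root_of_unity:
  assumes "primitive_root_of_unity N t" and "0 < N"
  shows "rogers_szego t P Q N = P ^ N + Q ^ N"
proof -
  have "rogers_szego t P Q N = (\<Sum>k\<in>{0, N}. sc (qbinom t N k) * (P ^ k * Q ^ (N - k)))"
    unfolding rogers_szego_def
    by (rule sum.mono_neutral_right) (auto simp: qbinom_root_of_unity[OF assms(1)] sc_0)
  then show ?thesis
    using assms(2) by (simp add: qbinom_self sc_1 add.commute)
qed

lemma ev_qhermite_root_of_unity:
  assumes "primitive_root_of_unity N t" and "0 < N"
    and "Q * P - sc t * (P * Q) - sc (\<gamma> * (1 - t)) \<in> I"
  shows "ev (qhermite t \<gamma> N) (P + Q) - (P ^ N + Q ^ N) \<in> I"
  using ev_qhermite[OF assms(3), of N] rogers_szego_root_of_unity[OF assms(1,2)] by simp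

text \<open>The case \<gamma> = 0, in which the Hermite polynomial of degree \<open>N\<close> is the
  monomial of degree \<open>N\<close>.\<close>

lemma qbinomial_root_of_unity:
  assumes "primitive_root_of_unity N t" and "0 < N" and "Q * P - sc t * (P * Q) \<in> I"
  shows "(P + Q) ^ N - (P ^ N + Q ^ N) \<in> I"
  using ev_qhermite_root_of_unity[of N t Q P 0] assms
  by (simp add: qhermite_0 ev_monom sc_0 sc_1)

end

text \<open>The commutative instance with zero ideal: commuting \<open>p\<close> and
  \<open>r\<close> satisfy the oscillator relation with \<gamma> = \<open>p * r\<close>.\<close>

lemma poly_qhermite_root_of_unity:
  fixes t :: "'k::field"
  assumes "primitive_root_of_unity N t" and "0 < N"
  shows "poly (qhermite t (p * r) N) (p + r) = p ^ N + r ^ N"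
proof -
  interpret central_quotient "\<lambda>c::'k. c" "{0}"
    by unfold_locales (auto simp: algebra_simps)
  have "ev (qhermite t (p * r) N) (p + r) = p ^ N + r ^ N"
    using ev_qhermite_root_of_unity[OF assms, of r p "p * r"] by (simp add: algebra_simps)
  then show ?thesis
    by (simp add: ev_def poly_altdef)
qed


section \<open>Roots of the minimal polynomial\<close>

lemma primitive_root_nonzero: "primitive_root_of_unity N t \<Longrightarrow> 0 < N \<Longrightarrow> t \<noteq> 0"
  by (auto simp: primitive_root_of_unity_def zero_power)

lemma primitive_root_power_diff:
  assumes "primitive_root_of_unity N t" and "i \<le> N"
  shows "t ^ (N - i) = 1 / t ^ i"
proof (cases "N = 0")
  case False
  have "t ^ (N - i) * t ^ i = 1"
    using assms by (simp add: primitive_root_of_unity_def power_add[symmetric])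
  then show ?thesis
    using primitive_root_nonzero[OF assms(1)] False by (simp add: field_simps)
qed (use assms in simp)

lemma primitive_root_inj_on:
  assumes "primitive_root_of_unity N t"
  shows "inj_on (\<lambda>k. t ^ k) {..<N}"
proof (rule linorder_inj_onI)
  fix i j
  assume ij: "i < j" "i \<in> {..<N}" "j \<in> {..<N}"
  then have "t \<noteq> 0"
    using primitive_root_nonzero[OF assms] by simp
  moreover have "t ^ j = t ^ i * t ^ (j - i)"
    using ij by (simp add: power_add[symmetric])
  moreover have "t ^ (j - i) \<noteq> 1"
    using assms ij by (simp add: primitive_root_of_unity_def)
  ultimately show "t ^ i \<noteq> t ^ j"
    by simp
qed auto

lemma primitive_root_inverse:
  assumes "primitive_root_of_unity N t"
  shows "primitive_root_of_unity N (1 / t)"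
  using assms by (auto simp: primitive_root_of_unity_def power_one_over)

lemma primitive_root_power_eq_1_iff:
  assumes "primitive_root_of_unity N t" and "0 < N"
  shows "t ^ m = 1 \<longleftrightarrow> N dvd m"
proof -
  have "t ^ m = (t ^ N) ^ (m div N) * t ^ (m mod N)"
    by (simp add: power_mult[symmetric] power_add[symmetric])
  then have "t ^ m = t ^ (m mod N)"
    using assms by (simp add: primitive_root_of_unity_def)
  then show ?thesis
    using assms by (metis primitive_root_of_unity_def dvd_eq_mod_eq_0 mod_less_divisor not_gr_zero power_0)
qed

text \<open>Since \<open>N\<close> is odd, \<open>N dvd 2 * k\<close> forces
  \<open>N dvd k\<close>.\<close>

lemma primitive_root_square:
  assumes "primitive_root_of_unity N q" and "odd N"
  shows "primitive_root_of_unity N (q\<^sup>2)"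
  unfolding primitive_root_of_unity_def
proof (intro conjI allI impI)
  show "(q\<^sup>2) ^ N = 1"
    using assms(1) by (metis primitive_root_of_unity_def power_mult mult.commute power_one)
next
  fix k
  assume k: "0 < k \<and> k < N"
  show "(q\<^sup>2) ^ k \<noteq> 1"
  proof
    assume "(q\<^sup>2) ^ k = 1"
    then have "N dvd 2 * k"
      using primitive_root_power_eq_1_iff[OF assms(1), of "2 * k"] k by (simp add: power_mult)
    then have "N dvd k"
      using assms(2) by (simp add: coprime_dvd_mult_right_iff coprime_right_2_iff_odd)
    then show False
      using k by (auto dest: dvd_imp_le)
  qed
qed

section \<open>Products of linear factors\<close>

text \<open>Distinctness of the roots allows dividing out one linear factor while the cofactor still
  vanishes at all the others.\<close>

lemma prod_linear_dvd_iff: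
  fixes p :: "'k::field poly"
  assumes "finite S" and "inj_on r S"
  shows "(\<Prod>a\<in>S. [:- r a, 1:]) dvd p \<longleftrightarrow> (\<forall>a\<in>S. poly p (r a) = 0)"
  using assms
proof (induction S arbitrary: p)
  case (insert b S)
  show ?case
  proof
    assume "(\<Prod>a\<in>insert b S. [:- r a, 1:]) dvd p"
    then show "\<forall>a\<in>insert b S. poly p (r a) = 0"
      using insert.hyps by (auto elim!: dvdE simp: poly_prod)
  next
    assume roots: "\<forall>a\<in>insert b S. poly p (r a) = 0"
    then obtain s where s: "p = [:- r b, 1:] * s"
      by (auto simp: poly_eq_0_iff_dvd)
    have "\<forall>a\<in>S. poly s (r a) = 0"
      using roots insert.hyps insert.prems by (auto simp: s inj_on_def)
    then show "(\<Prod>a\<in>insert b S. [:- r a, 1:]) dvd p"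
      using insert by (auto simp: s intro: mult_dvd_mono simp del: mult_pCons_left)
  qed
qed simp

lemma prod_linear_nonzero: "(\<Prod>a\<in>S. [:- r a, 1:: 'k::field:]) \<noteq> 0"
  by (induction S rule: infinite_finite_induct) (auto simp del: mult_pCons_left)

lemma degree_prod_linear: "degree (\<Prod>a\<in>S. [:- r a, 1:: 'k::field:]) = card S"
  by (induction S rule: infinite_finite_induct)
    (auto simp: degree_mult_eq prod_linear_nonzero simp del: mult_pCons_left)

lemma lead_coeff_prod_linear: "lead_coeff (\<Prod>a\<in>S. [:- r a, 1:: 'k::field:]) = 1"
  by (simp add: lead_coeff_prod)

text \<open>The product of the \<open>X - t ^ k\<close> divides \<open>X ^ N - 1\<close>, and both
  are monic of degree \<open>N\<close>, so they agree. Evaluating at \<open>a / b\<close> and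
  clearing denominators gives the homogeneous form, which is why \<open>b = 0\<close> is treated
  apart.\<close>

lemma prod_root_of_unity:
  fixes t :: "'k::field"
  assumes "primitive_root_of_unity N t" and "0 < N"
  shows "(\<Prod>k<N. a - b * t ^ k) = a ^ N - b ^ N"
proof (cases "b = 0")
  case True
  with assms show ?thesis
    by simp
next
  case False
  let ?P = "\<Prod>k<N. [:- (t ^ k), 1:]" and ?X = "monom 1 N - 1 :: 'k poly"
  have eq: "?P = ?X"
  proof -
    have deg: "degree ?X = N" "lead_coeff ?X = 1"
    proof -
      have "degree (monom 1 N + (-1) :: 'k poly) = N"
        using assms(2) by (subst degree_add_eq_left) (simp_all add: degree_monom_eq)
      then show "degree ?X = N"
        by simp
      then show "lead_coeff ?X = 1"
        using assms(2) by simp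
    qed
    have "?P dvd ?X"
      using assms by (subst prod_linear_dvd_iff[OF _ primitive_root_inj_on])
        (auto simp: poly_monom primitive_root_of_unity_def power_mult[symmetric] mult.commute
          simp del: power_mult, metis power_mult mult.commute power_one)
    then obtain s where s: "?X = ?P * s"
      by (elim dvdE)
    then have "s \<noteq> 0"
      using deg assms(2) by auto
    then have "degree s = 0"
      using arg_cong[OF s, of degree] deg degree_prod_linear[of "\<lambda>k. t ^ k" "{..<N}"]
      by (subst (asm) degree_mult_eq) (auto simp: prod_linear_nonzero)
    moreover have "lead_coeff s = 1"
      using arg_cong[OF s, of lead_coeff] deg lead_coeff_prod_linear[of "\<lambda>k. t ^ k" "{..<N}"]
      by (subst (asm) lead_coeff_mult) simp
    ultimately have "s = 1"
      by (metis degree_eq_zeroE lead_coeff_pCons(2) one_pCons pCons_0_0 coeff_pCons_0 degree_pCons_0)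
    then show ?thesis
      using s by simp
  qed
  have "(\<Prod>k<N. a - b * t ^ k) = (\<Prod>k<N. b * (a / b - t ^ k))"
    using False by (intro prod.cong) (auto simp: field_simps)
  also have "\<dots> = b ^ N * poly ?P (a / b)"
    by (simp add: prod.distrib poly_prod)
  also have "\<dots> = a ^ N - b ^ N"
    unfolding eq using False by (simp add: poly_monom field_simps)
  finally show ?thesis .
qed

text \<open>Both sides are evaluated at \<open>z = p + x * y / p\<close>; the nonzero elements \<open>p\<close> yield all
  but at most one value \<open>z\<close>.\<close>

lemma qhermite_diff_const:
  fixes t :: "'k::{alg_closed_field, field_char_0}"
  assumes t: "primitive_root_of_unity N t" "0 < N"
  shows "qhermite t (x * y) N - [:x ^ N + y ^ N:] = (\<Prod>k<N. [:- (x * t ^ k + y / t ^ k), 1:])"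
    (is "?L = ?R")
proof -
  have t0: "t \<noteq> 0"
    using t by (rule primitive_root_nonzero)
  have eq: "poly ?L z = poly ?R z" if "z \<noteq> 0" for z
  proof -
    \<comment> \<open>The two roots \<open>p\<close> and \<open>r\<close> of this quadratic have sum
      \<open>z\<close> and product \<open>x * y\<close>.\<close>
    have "degree [:x * y, - z, 1:] > 0"
      by simp
    then obtain p where p: "poly [:x * y, - z, 1:] p = 0"
      using alg_closed_imp_poly_has_root by blast
    define r where "r = z - p"
    have pr: "p * r = x * y" "z = p + r"
      using p by (simp_all add: r_def algebra_simps eq_neg_iff_add_eq_0)
    have main: "poly ?R (p + r) = p ^ N + r ^ N - (x ^ N + y ^ N)"
      if pr: "p * r = x * y" and p0: "p \<noteq> 0" for p r
    proof -
      have r: "r = x * y / p"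
        using pr p0 by (simp add: field_simps)
      \<comment> \<open>At \<open>p + x * y / p\<close> each linear factor splits into two, so the
        product becomes two instances of \<open>prod_root_of_unity\<close>, for \<open>t\<close> and
        for \<open>1 / t\<close>.\<close>
      have "poly ?R (p + r) = (\<Prod>k<N. (p - x * t ^ k) * (1 - (y / p) * (1 / t) ^ k))"
        unfolding poly_prod r
        by (rule prod.cong[OF refl]) (use p0 t0 in \<open>simp add: field_simps power_one_over\<close>)
      also have "\<dots> = (p ^ N - x ^ N) * (1 - (y / p) ^ N)"
        using prod_root_of_unity[OF t, of p x]
          prod_root_of_unity[OF primitive_root_inverse[OF t(1)] t(2), of 1 "y / p"]
        unfolding prod.distrib by (simp only: power_one)
      also have "\<dots> = p ^ N + r ^ N - (x ^ N + y ^ N)"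
        unfolding r using p0 by (simp add: field_simps)
      finally show ?thesis .
    qed
    \<comment> \<open>Since \<open>z\<close> is nonzero, \<open>p\<close> and \<open>r\<close> do
      not both vanish; if \<open>p = 0\<close>, they exchange roles.\<close>
    have "poly ?R z = p ^ N + r ^ N - (x ^ N + y ^ N)"
    proof (cases "p = 0")
      case True
      then have "r \<noteq> 0"
        using that pr by simp
      with main[of r p] pr show ?thesis
        by (simp add: mult.commute add.commute)
    qed (use main[of p r] pr in simp)
    then show ?thesis
      using poly_qhermite_root_of_unity[OF t, of p r] pr by simp
  qed
  have "infinite {z. poly (?L - ?R) z = 0}"
  proof
    assume "finite {z. poly (?L - ?R) z = 0}"
    moreover have "UNIV - {0} \<subseteq> {z. poly (?L - ?R) z = 0}"
      using eq by auto
    ultimately have "finite (UNIV - {0} :: 'k set)"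
      by (rule finite_subset[rotated])
    then show False
      by (simp add: infinite_UNIV_char_0)
  qed
  then show ?thesis
    using poly_roots_finite[of "?L - ?R"] by auto
qed

section \<open>The roots of the minimal polynomial and their collisions\<close>

text \<open>Pairs \<open>k\<close> with \<open>N - k\<close>; oddness leaves only the index
  \<open>0\<close> unpaired. This produces the quadratic factors of \<open>phi_poly\<close>.\<close>

lemma prod_odd_symmetric:
  fixes f :: "nat \<Rightarrow> 'b::comm_monoid_mult"
  assumes "odd N"
  shows "(\<Prod>k<N. f k) = f 0 * (\<Prod>k = 1..(N - 1) div 2. f k * f (N - k))"
proof -
  let ?m = "(N - 1) div 2"
  have N: "N = 2 * ?m + 1"
    using assms by simp
  have "bij_betw (\<lambda>k. N - k) {1..?m} {?m<..<N}"
    by (rule bij_betwI[of _ _ _ "\<lambda>k. N - k"]) (use N in auto)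
  then have "(\<Prod>k = 1..?m. f (N - k)) = (\<Prod>k\<in>{?m<..<N}. f k)"
    by (rule prod.reindex_bij_betw)
  moreover have "{..<N} = insert 0 ({1..?m} \<union> {?m<..<N})"
    using N by auto
  moreover have "{1..?m} \<inter> {?m<..<N} = {}"
    by auto
  ultimately show ?thesis
    by (simp add: prod.distrib prod.union_disjoint)
qed

text \<open>With \<open>s = q ^ (2 * k)\<close> the roots of index \<open>k\<close> and
  \<open>N - k\<close> are \<open>x * s + y / s\<close> and \<open>x / s + y * s\<close>. Their sum
  is \<beta> times \<open>s + 1 / s\<close>, and their product is the square of \<beta> plus
  \<open>x * y\<close> times the square of \<open>s - 1 / s\<close>. Index \<open>0\<close> gives
  the root \<beta>.\<close>

lemma phi_poly_factorization:
  fixes q :: "'k::field"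
  assumes q: "primitive_root_of_unity N q" and "odd N" and "q\<^sup>2 \<noteq> 1"
    and xy: "x + y = \<beta>" "x * y = \<alpha> / (1 - q\<^sup>2)"
  shows "phi_poly N q \<alpha> \<beta> = (\<Prod>k<N. [:- (x * (q\<^sup>2) ^ k + y / (q\<^sup>2) ^ k), 1:])"
proof -
  let ?t = "q\<^sup>2"
  have q0: "q \<noteq> 0"
    using q assms(2) by (intro primitive_root_nonzero) (auto intro: Nat.gr0I)
  have quad: "[:- (x * ?t ^ k + y / ?t ^ k), 1:] * [:- (x * ?t ^ (N - k) + y / ?t ^ (N - k)), 1:] =
      [: \<beta>\<^sup>2 + (q ^ (2 * k) - 1 / q ^ (2 * k))\<^sup>2 / (1 - q\<^sup>2) * \<alpha>,
         - \<beta> * (q ^ (2 * k) + 1 / q ^ (2 * k)), 1 :]" if "k \<le> N" for k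
  proof -
    define s where "s = ?t ^ k"
    have s0: "s \<noteq> 0"
      using q0 by (simp add: s_def)
    have s: "q ^ (2 * k) = s" "?t ^ (N - k) = 1 / s"
      using primitive_root_power_diff[OF primitive_root_square[OF q assms(2)] that]
      by (simp_all add: s_def power_mult)
    have "(q ^ (2 * k) - 1 / q ^ (2 * k))\<^sup>2 / (1 - q\<^sup>2) * \<alpha> = (s - 1 / s)\<^sup>2 * (x * y)"
      by (simp add: xy s)
    then show ?thesis
      unfolding s s_def[symmetric] using s0
      by (simp add: xy(1)[symmetric] field_simps power2_eq_square)
  qed
  then show ?thesis
    unfolding prod_odd_symmetric[OF assms(2)] phi_poly_def
    by (intro arg_cong2[of _ _ _ _ "(*)"] prod.cong) (use xy(1) in auto)
qed

text \<open>In terms of \<open>x\<close> and \<open>y\<close>, each \<open>D_factor\<close> is a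
  difference that splits into \<open>x - y * t ^ k\<close> and \<open>x - y / t ^ k\<close>, where
  \<open>t\<close> is the square of \<open>q\<close>.\<close>

lemma D_total_eq_0_iff:
  fixes q :: "'k::field"
  assumes q: "primitive_root_of_unity N q" and "odd N" and "N > 1" and "q\<^sup>2 \<noteq> 1"
    and xy: "x + y = \<beta>" "x * y = \<alpha> / (1 - q\<^sup>2)"
  shows "D_total N q \<alpha> \<beta> = 0 \<longleftrightarrow> (\<exists>m<N. x = y * (q\<^sup>2) ^ m)"
proof -
  let ?t = "q\<^sup>2"
  have t: "primitive_root_of_unity N ?t"
    using q assms(2) by (rule primitive_root_square)
  have q0: "q \<noteq> 0"
    using q assms(3) by (intro primitive_root_nonzero) auto
  have D: "D_factor q k \<alpha> \<beta> = (x - y * ?t ^ k) * (x - y * (1 / ?t ^ k))" for k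
  proof -
    define s where "s = q ^ k"
    have "s \<noteq> 0"
      using q0 by (simp add: s_def)
    moreover have "?t ^ k = s\<^sup>2"
      by (simp add: s_def power_mult[symmetric] mult.commute)
    moreover have "D_factor q k \<alpha> \<beta> = (x + y)\<^sup>2 - (s + 1 / s)\<^sup>2 * (x * y)"
      by (simp add: D_factor_def xy s_def)
    ultimately show ?thesis
      by (simp add: field_simps power2_eq_square)
  qed
  \<comment> \<open>The exponent \<open>- k\<close> is replaced by \<open>N - k\<close>;
    \<open>k = 0\<close> is kept apart because \<open>N - 0\<close> is out of range.\<close>
  have "\<exists>m<N. x = y * ?t ^ m" if "k < N" "x = y * (1 / ?t ^ k)" for k
  proof (cases "k = 0")
    case False
    then have "N - k < N"
      using that by simp
    moreover have "x = y * ?t ^ (N - k)"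
      using that primitive_root_power_diff[OF t, of k] by simp
    ultimately show ?thesis
      by blast
  qed (use that in auto)
  moreover have "D_total N q \<alpha> \<beta> = (\<Prod>k<N. D_factor q k \<alpha> \<beta>)"
    unfolding D_total_def using assms(3) by (intro prod.cong) auto
  ultimately show ?thesis
    unfolding D by (auto simp: prod_zero_iff)
qed

text \<open>The difference of two values, times \<open>t ^ (k + j)\<close>, factors as
  \<open>(t ^ k - t ^ j) * (x * t ^ (k + j) - y)\<close>. Hence two distinct indices collide exactly
  when \<open>x * t ^ (k + j) = y\<close>.\<close>

lemma roots_inj_on_iff:
  fixes t :: "'k::field"
  assumes t: "primitive_root_of_unity N t" and "N > 2"
  shows "inj_on (\<lambda>k. x * t ^ k + y / t ^ k) {..<N} \<longleftrightarrow> \<not> (\<exists>m<N. x = y * t ^ m)"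
proof -
  have t0: "t \<noteq> 0"
    using t assms(2) by (intro primitive_root_nonzero) auto
  have diff: "x * t ^ k + y / t ^ k = x * t ^ j + y / t ^ j \<longleftrightarrow> x * t ^ (k + j) = y"
    if "k < N" "j < N" "k \<noteq> j" for k j
  proof -
    have "t ^ k \<noteq> t ^ j"
      using primitive_root_inj_on[OF t] that by (auto simp: inj_on_def)
    moreover have "(x * t ^ k + y / t ^ k - (x * t ^ j + y / t ^ j)) * t ^ (k + j)
        = (t ^ k - t ^ j) * (x * t ^ (k + j) - y)"
      using t0 by (simp add: power_add field_simps)
    ultimately show ?thesis
      using t0 by (metis eq_iff_diff_eq_0 mult_eq_0_iff power_not_zero)
  qed
  have 1: "\<exists>m<N. x = y * t ^ m" if "x * t ^ n = y" for n
  proof -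
    define j where "j = n mod N"
    have "t ^ n = (t ^ N) ^ (n div N) * t ^ j"
      by (simp add: j_def power_mult[symmetric] power_add[symmetric])
    then have "t ^ n = t ^ j"
      using t by (simp add: primitive_root_of_unity_def)
    moreover have "j < N"
      using assms(2) by (simp add: j_def)
    ultimately have "x = y * t ^ (if j = 0 then 0 else N - j)"
      using that t0 primitive_root_power_diff[OF t, of j] by (auto simp: field_simps)
    then show ?thesis
      using \<open>j < N\<close> by (intro exI[of _ "if j = 0 then 0 else N - j"]) auto
  qed
  \<comment> \<open>For \<open>m = 0\<close> the indices \<open>1\<close> and \<open>N - 1\<close>
    collide, distinct because \<open>N > 2\<close>; for other \<open>m\<close> the indices
    \<open>0\<close> and \<open>N - m\<close> do.\<close>
  have 2: "\<exists>k<N. \<exists>j<N. k \<noteq> j \<and> x * t ^ (k + j) = y" if "m < N" "x = y * t ^ m" for m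
  proof (cases "m = 0")
    case True
    then have "x * t ^ (1 + (N - 1)) = y"
      using that t by (simp add: primitive_root_of_unity_def power_Suc[symmetric] del: power_Suc)
    then show ?thesis
      using assms(2) by (intro exI[of _ 1] conjI exI[of _ "N - 1"]) auto
  next
    case False
    then have "x * t ^ (0 + (N - m)) = y"
      using that t0 primitive_root_power_diff[OF t, of m] by simp
    then show ?thesis
      using that False by (intro exI[of _ 0] conjI exI[of _ "N - m"]) auto
  qed
  show ?thesis
    using 1 2 diff unfolding inj_on_def by (metis lessThan_iff)
qed


section \<open>Algebras presented as quotients of a polynomial algebra\<close>

text \<open>For a minimal ideal \<open>L\<close>, the ideal \<open>n L\<close> is zero or
  \<open>L\<close>; in the second case every element of \<open>L\<close> is
  \<open>n \<otimes> y\<close> and is killed by \<open>n\<close> since \<open>n\<close> squares to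
  zero. So \<open>n\<close> kills every summand, hence also \<one>.\<close>

lemma (in cring) semisimple_imp_reduced:
  assumes "semisimple_algebra R" and n: "n \<in> carrier R" "n \<otimes> n = \<zero>"
  shows "n = \<zero>"
proof -
  obtain S where S: "finite S" "\<forall>L\<in>S. simple_left_ideal L R"
    and dec: "\<forall>x\<in>carrier R. \<exists>!f. f \<in> (\<Pi>\<^sub>E L\<in>S. L) \<and> x = (\<Oplus>L\<in>S. f L)"
    using assms(1) unfolding semisimple_algebra_def by blast
  have kill: "n \<otimes> x = \<zero>" if L: "L \<in> S" and x: "x \<in> L" for L x
  proof -
    have ideal: "left_ideal L R" and min: "\<And>J. left_ideal J R \<Longrightarrow> J \<subseteq> L \<Longrightarrow> J = {\<zero>} \<or> J = L"
      using S(2) L unfolding simple_left_ideal_def by auto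
    interpret L: additive_subgroup L R
      using ideal by (simp add: left_ideal_def)
    have mult: "a \<otimes> y \<in> L" if "a \<in> carrier R" "y \<in> L" for a y
      using ideal that by (auto simp: left_ideal_def)
    have "left_ideal ((\<lambda>y. n \<otimes> y) ` L) R"
      unfolding left_ideal_def
    proof (intro conjI ballI additive_subgroup.intro add.subgroupI)
      fix z z'
      assume "z \<in> (\<lambda>y. n \<otimes> y) ` L" "z' \<in> (\<lambda>y. n \<otimes> y) ` L"
      then obtain y y' where "z = n \<otimes> y" "y \<in> L" "z' = n \<otimes> y'" "y' \<in> L"
        by blast
      then show "z \<oplus> z' \<in> (\<lambda>y. n \<otimes> y) ` L" and "\<ominus> z \<in> (\<lambda>y. n \<otimes> y) ` L"
        using n(1) by (auto simp: r_distr[symmetric] r_minus[symmetric] intro!: imageI)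
    next
      fix a z
      assume "a \<in> carrier R" "z \<in> (\<lambda>y. n \<otimes> y) ` L"
      then obtain y where y: "z = n \<otimes> y" "y \<in> L"
        by blast
      then have "a \<otimes> z = n \<otimes> (a \<otimes> y)"
        using n(1) \<open>a \<in> carrier R\<close> by (simp add: m_lcomm)
      then show "a \<otimes> z \<in> (\<lambda>y. n \<otimes> y) ` L"
        using y \<open>a \<in> carrier R\<close> by (auto intro: mult)
    qed (use n(1) L.zero_closed in \<open>auto simp del: L.zero_closed\<close>)
    moreover have "(\<lambda>y. n \<otimes> y) ` L \<subseteq> L"
      using n(1) mult by auto
    ultimately consider "(\<lambda>y. n \<otimes> y) ` L = {\<zero>}" | "(\<lambda>y. n \<otimes> y) ` L = L"
      using min by blast
    then show ?thesis
    proof cases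
      case 1
      with x show ?thesis
        by blast
    next
      case 2
      then obtain y where "y \<in> L" "x = n \<otimes> y"
        using x by blast
      then show ?thesis
        using n by (simp add: m_assoc[symmetric])
    qed
  qed
  obtain f where f: "f \<in> (\<Pi>\<^sub>E L\<in>S. L)" "\<one> = (\<Oplus>L\<in>S. f L)"
    using dec by blast
  have fL: "f L \<in> L" if "L \<in> S" for L
    using f that by auto
  have "f \<in> S \<rightarrow> carrier R"
  proof
    fix L
    assume L: "L \<in> S"
    then have "additive_subgroup L R"
      using S(2) by (simp add: simple_left_ideal_def left_ideal_def)
    then show "f L \<in> carrier R"
      using fL[OF L] additive_subgroup.a_subset by blast
  qed
  then have "n \<otimes> \<one> = (\<Oplus>L\<in>S. n \<otimes> f L)"
    unfolding f(2) using S(1) n(1) by (intro finsum_rdistr)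
  also have "\<dots> = (\<Oplus>L\<in>S. \<zero>)"
    using kill fL by (intro finsum_cong') auto
  finally show ?thesis
    using n(1) by simp
qed

text \<open>A presentation of \<open>R\<close> as polynomials modulo \<phi>, given by a surjection
  \<open>h\<close> whose kernel is the multiples of \<phi>. Both \<open>uq_A\<close> and the
  quotient of \<open>poly_algebra\<close> are instances, so each property is proved once.\<close>

locale poly_quotient = ring R for R :: "('k::field, 'b) module" (structure) +
  fixes h :: "'k poly \<Rightarrow> 'b" and \<phi> :: "'k poly"
  assumes h_add: "h (p + r) = h p \<oplus> h r"
    and h_mult: "h (p * r) = h p \<otimes> h r"
    and h_1: "h 1 = \<one>"
    and h_smult: "h (smult c p) = c \<odot> h p"
    and range_h: "range h = carrier R"
    and h_eq_0_iff: "h p = \<zero> \<longleftrightarrow> \<phi> dvd p"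
begin

lemma h_closed [simp]: "h p \<in> carrier R"
  using range_h by blast

lemma h_0: "h 0 = \<zero>"
  by (simp add: h_eq_0_iff)

lemma h_minus: "h (- p) = \<ominus> h p"
  using h_add[of "- p" p] by (intro minus_equality[symmetric]) (simp_all add: h_0)

lemma h_eq_iff: "h p = h r \<longleftrightarrow> \<phi> dvd p - r"
proof -
  have "h (p - r) = h p \<ominus> h r"
    using h_add[of p "- r"] by (simp add: h_minus a_minus_def)
  then show ?thesis
    by (metis h_eq_0_iff h_closed r_right_minus_eq)
qed

lemma h_sum: "finite S \<Longrightarrow> h (sum f S) = (\<Oplus>i\<in>S. h (f i))"
  by (induction S rule: finite_induct) (simp_all add: h_0 h_add)

lemma is_cring: "cring R"
proof (rule cringI[OF is_abelian_group _ l_distr])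
  have "x \<otimes> y = y \<otimes> x" if "x \<in> range h" "y \<in> range h" for x y
    using that by (metis imageE h_mult mult.commute)
  then show "comm_monoid R"
    unfolding range_h by (intro monoid_comm_monoidI)
qed

text \<open>A class is lifted to any polynomial and pushed down again; the choice of lift is
  irrelevant because both kernels consist of the multiples of \<phi>.\<close>

lemma isomorphic:
  assumes "poly_quotient R' h' \<phi>"
  shows "algebra_isomorphic R R'"
proof -
  interpret R': poly_quotient R' h' \<phi>
    by fact
  define \<theta> where "\<theta> x = h' (inv_into UNIV h x)" for x
  have \<theta>: "\<theta> (h p) = h' p" for p
  proof -
    have "h (inv_into UNIV h (h p)) = h p"
      by (simp add: f_inv_into_f)
    then show ?thesis
      by (simp add: \<theta>_def h_eq_iff R'.h_eq_iff)
  qed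
  have "bij_betw \<theta> (range h) (range h')"
    unfolding bij_betw_def inj_on_def by (auto simp: image_image \<theta> h_eq_iff R'.h_eq_iff)
  then have "bij_betw \<theta> (carrier R) (carrier R')"
    by (simp add: range_h R'.range_h)
  moreover have "x \<in> carrier R \<longleftrightarrow> (\<exists>p. x = h p)" for x
    using range_h by blast
  ultimately have "\<theta> \<in> algebra_iso R R'"
    unfolding algebra_iso_def
    by (auto simp: \<theta> h_1[symmetric] R'.h_1[symmetric] h_mult[symmetric] h_add[symmetric]
      h_smult[symmetric] R'.h_mult R'.h_add R'.h_smult intro!: ring_iso_memI)
  then show ?thesis
    by (auto simp: algebra_isomorphic_def)
qed

lemma h_ideal:
  assumes "0 \<in> P" and "\<And>p r. p \<in> P \<Longrightarrow> r \<in> P \<Longrightarrow> p + r \<in> P" and "\<And>p r. p \<in> P \<Longrightarrow> r * p \<in> P"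
  shows "left_ideal (h ` P) R"
  unfolding left_ideal_def
proof (intro conjI ballI additive_subgroup.intro add.subgroupI)
  fix x y
  assume "x \<in> h ` P" "y \<in> h ` P"
  then show "x \<oplus> y \<in> h ` P"
    using assms(2) by (auto simp: h_add[symmetric])
next
  fix x
  assume "x \<in> h ` P"
  then obtain p where "x = h p" "p \<in> P"
    by blast
  then show "\<ominus> x \<in> h ` P"
    using assms(3)[of p "-1"] by (auto simp: h_minus[symmetric])
next
  fix a x
  assume "a \<in> carrier R" "x \<in> h ` P"
  then obtain p r where "a = h r" "x = h p" "p \<in> P"
    using range_h by blast
  then show "a \<otimes> x \<in> h ` P"
    using assms(3) by (auto simp: h_mult[symmetric])
qed (use assms(1) in auto)

text \<open>Dropping one of two equal linear factors leaves a polynomial \<open>p\<close> of too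
  small a degree to be divisible by \<phi>, although \<phi> divides \<open>p * p\<close>: its class
  is a nonzero nilpotent.\<close>

lemma not_semisimple:
  assumes "finite S" and \<phi>: "\<phi> = (\<Prod>a\<in>S. [:- r a, 1:])"
    and ab: "a \<in> S" "b \<in> S" "a \<noteq> b" "r a = r b"
  shows "\<not> semisimple_algebra R"
proof
  assume ss: "semisimple_algebra R"
  define p where "p = (\<Prod>c\<in>S - {a}. [:- r c, 1:])"
  have S: "S = insert a (S - {a})" "S - {a} = insert b (S - {a} - {b})"
    using ab by auto
  have phi: "\<phi> = [:- r a, 1:] * p"
    unfolding \<phi> p_def by (subst S(1), subst prod.insert) (use assms(1) in auto)
  have "[:- r a, 1:] dvd p"
    unfolding p_def ab(4) by (subst S(2), subst prod.insert) (use assms(1) in \<open>auto simp del: mult_pCons_left\<close>)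
  then have "\<phi> dvd p * p"
    unfolding phi by (rule mult_dvd_mono) (rule dvd_refl)
  then have "h p \<otimes> h p = \<zero>"
    by (simp add: h_mult[symmetric] h_eq_0_iff)
  then have "h p = \<zero>"
    by (rule cring.semisimple_imp_reduced[OF is_cring ss h_closed])
  then have "\<phi> dvd p"
    by (simp add: h_eq_0_iff)
  moreover have "p \<noteq> 0"
    unfolding p_def by (rule prod_linear_nonzero)
  ultimately have "degree \<phi> \<le> degree p"
    by (rule dvd_imp_degree_le)
  then show False
    unfolding phi using \<open>p \<noteq> 0\<close> by (subst (asm) degree_mult_eq) auto
qed

text \<open>Chinese remaindering: a class is determined by its values at the distinct roots. The
  classes supported at a single root form a one-dimensional ideal, and these ideals are the
  summands.\<close>

lemma semisimple:
  assumes fin: "finite S" and \<phi>: "\<phi> = (\<Prod>a\<in>S. [:- r a, 1:])" and inj: "inj_on r S"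
  shows "semisimple_algebra R"
proof -
  have h_eq: "h p = h s \<longleftrightarrow> (\<forall>a\<in>S. poly p (r a) = poly s (r a))" for p s
    unfolding h_eq_iff \<phi> prod_linear_dvd_iff[OF fin inj] by simp
  have h_eq_0: "h p = \<zero> \<longleftrightarrow> (\<forall>a\<in>S. poly p (r a) = 0)" for p
    using h_eq[of p 0] by (simp add: h_0)
  \<comment> \<open>Lagrange basis polynomials; their classes are orthogonal idempotents.\<close>
  define e where "e a = (\<Prod>b\<in>S - {a}. smult (1 / (r a - r b)) [:- r b, 1:])" for a
  have e: "poly (e a) (r b) = (if b = a then 1 else 0)" if "a \<in> S" "b \<in> S" for a b
    unfolding e_def poly_prod using that fin inj
    by (auto simp: inj_on_def prod_zero_iff diff_divide_distrib[symmetric] split: if_splits intro!: prod.neutral bexI[of _ b])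
  define L where "L a = h ` {p. \<forall>b\<in>S - {a}. poly p (r b) = 0}" for a
  have e_in: "h (e a) \<in> L a" if "a \<in> S" for a
    unfolding L_def using e that by (intro imageI) auto
  have L_ideal: "left_ideal (L a) R" for a
    unfolding L_def by (rule h_ideal) auto
  have simple: "simple_left_ideal (L a) R" if a: "a \<in> S" for a
    unfolding simple_left_ideal_def
  proof (intro conjI allI impI L_ideal)
    show "L a \<noteq> {\<zero>}"
      using e_in[OF a] e[OF a a] a h_eq_0[of "e a"] by auto
  next
    fix J
    assume J: "left_ideal J R \<and> J \<subseteq> L a"
    interpret J: additive_subgroup J R
      using J by (simp add: left_ideal_def)
    show "J = {\<zero>} \<or> J = L a"
    proof (rule disjCI)
      assume "J \<noteq> L a"
      show "J = {\<zero>}"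
      proof (rule ccontr)
        assume "J \<noteq> {\<zero>}"
        then obtain x where x: "x \<in> J" "x \<noteq> \<zero>"
          using J.zero_closed by blast
        then obtain p where p: "x = h p" "\<forall>b\<in>S - {a}. poly p (r b) = 0"
          using J unfolding L_def by blast
        then have pa: "poly p (r a) \<noteq> 0"
          using x(2) h_eq_0[of p] by auto
        have "y \<in> J" if "y \<in> L a" for y
        proof -
          obtain s where s: "y = h s" "\<forall>b\<in>S - {a}. poly s (r b) = 0"
            using \<open>y \<in> L a\<close> unfolding L_def by blast
          \<comment> \<open>Elements of \<open>L a\<close> are determined by their value at
            \<open>r a\<close>, so each is a scalar multiple of the nonzero \<open>x\<close> and
            lies in \<open>J\<close>.\<close>
          have "h s = h ([:poly s (r a) / poly p (r a):] * p)"
            unfolding h_eq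
          proof
            fix b
            assume "b \<in> S"
            then show "poly s (r b) = poly ([:poly s (r a) / poly p (r a):] * p) (r b)"
              using s(2) p(2) pa by (cases "b = a") auto
          qed
          then have "y = h [:poly s (r a) / poly p (r a):] \<otimes> x"
            by (simp only: s p h_mult)
          then show ?thesis
            using J x(1) unfolding left_ideal_def by simp
        qed
        then show False
          using J \<open>J \<noteq> L a\<close> by blast
      qed
    qed
  qed
  \<comment> \<open>The summands are indexed by the ideals themselves, so sums over roots can be
    reindexed only if distinct roots give distinct ideals.\<close>
  have L_inj: "inj_on L S"
  proof (rule inj_onI, rule ccontr)
    fix a b
    assume ab: "a \<in> S" "b \<in> S" "L a = L b" "a \<noteq> b"
    then obtain p where "h (e a) = h p" "\<forall>c\<in>S - {b}. poly p (r c) = 0"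
      using e_in[of a] unfolding L_def by force
    then show False
      using ab e[of a a] by (auto simp: h_eq)
  qed
  \<comment> \<open>Multiplication by the idempotent of \<open>a\<close> extracts the component in
    \<open>L a\<close> from any decomposition, which gives uniqueness.\<close>
  have decomp: "h (e a * p) = f (L a)"
    if f: "f \<in> (\<Pi>\<^sub>E M\<in>L ` S. M)" "h p = (\<Oplus>M\<in>L ` S. f M)" and a: "a \<in> S" for f p a
  proof -
    have "\<forall>b\<in>S. \<exists>s. f (L b) = h s \<and> (\<forall>c\<in>S - {b}. poly s (r c) = 0)"
    proof
      fix b
      assume "b \<in> S"
      then have "f (L b) \<in> L b"
        using f(1) by auto
      then show "\<exists>s. f (L b) = h s \<and> (\<forall>c\<in>S - {b}. poly s (r c) = 0)"
        unfolding L_def by auto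
    qed
    then obtain s where s: "\<And>b. b \<in> S \<Longrightarrow> f (L b) = h (s b)"
        "\<And>b c. b \<in> S \<Longrightarrow> c \<in> S \<Longrightarrow> c \<noteq> b \<Longrightarrow> poly (s b) (r c) = 0"
      by (metis DiffI singletonD)
    have "h p = (\<Oplus>b\<in>S. f (L b))"
      unfolding f(2) using L_inj by (intro finsum_reindex) (auto simp: s)
    also have "\<dots> = h (\<Sum>b\<in>S. s b)"
      unfolding h_sum[OF fin] by (intro finsum_cong') (auto simp: s)
    finally have "\<forall>c\<in>S. poly p (r c) = (\<Sum>b\<in>S. poly (s b) (r c))"
      by (simp add: h_eq poly_sum)
    moreover have "(\<Sum>b\<in>S. poly (s b) (r c)) = poly (s c) (r c)" if "c \<in> S" for c
    proof -
      have "(\<Sum>b\<in>S. poly (s b) (r c)) = (\<Sum>b\<in>{c}. poly (s b) (r c))"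
        using fin that s(2) by (intro sum.mono_neutral_right) auto
      then show ?thesis
        by simp
    qed
    ultimately have "h (e a * p) = h (s a)"
      unfolding h_eq using a s(2) by (auto simp: e)
    then show ?thesis
      by (simp add: s a)
  qed
  show ?thesis
    unfolding semisimple_algebra_def
  proof (intro exI[of _ "L ` S"] conjI ballI)
    fix x
    assume "x \<in> carrier R"
    then obtain p where p: "x = h p"
      using range_h by blast
    \<comment> \<open>The inverse of \<open>L\<close> recovers the root from its ideal; the
      restricted lambda supplies the default value outside the family that the extensional product
      demands.\<close>
    define f where "f = (\<lambda>M\<in>L ` S. h (e (the_inv_into S L M) * p))"
    have fL: "f (L a) = h (e a * p)" if "a \<in> S" for a
      using that L_inj by (simp add: f_def the_inv_into_f_f)
    have "f \<in> (\<Pi>\<^sub>E M\<in>L ` S. M)"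
    proof (rule PiE_I)
      fix M
      assume "M \<in> L ` S"
      then obtain a where "a \<in> S" "M = L a"
        by blast
      moreover have "h (e a * p) \<in> L a"
        unfolding L_def using e \<open>a \<in> S\<close> by (intro imageI) auto
      ultimately show "f M \<in> M"
        by (simp add: fL)
    qed (simp add: f_def)
    moreover have "x = (\<Oplus>M\<in>L ` S. f M)"
    proof -
      have "h p = h (\<Sum>a\<in>S. e a * p)"
        unfolding h_eq
      proof
        fix c
        assume "c \<in> S"
        then have "(\<Sum>a\<in>S. poly (e a) (r c) * poly p (r c)) = (\<Sum>a\<in>S. if c = a then poly p (r c) else 0)"
          by (intro sum.cong) (auto simp: e)
        then show "poly p (r c) = poly (\<Sum>a\<in>S. e a * p) (r c)"
          using fin \<open>c \<in> S\<close> by (simp add: poly_sum)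
      qed
      also have "\<dots> = (\<Oplus>a\<in>S. f (L a))"
        unfolding h_sum[OF fin] by (intro finsum_cong') (auto simp: fL)
      also have "\<dots> = (\<Oplus>M\<in>L ` S. f M)"
        using L_inj by (intro finsum_reindex[symmetric]) (auto simp: fL)
      finally show ?thesis
        by (simp add: p)
    qed
    moreover have "g = f'"
      if "g \<in> (\<Pi>\<^sub>E M\<in>L ` S. M)" "x = (\<Oplus>M\<in>L ` S. g M)"
        "f' \<in> (\<Pi>\<^sub>E M\<in>L ` S. M)" "x = (\<Oplus>M\<in>L ` S. f' M)" for g f'
    proof (rule PiE_ext[OF that(1,3)])
      fix M
      assume "M \<in> L ` S"
      then obtain a where "a \<in> S" "M = L a"
        by blast
      then show "g M = f' M"
        using decomp[OF that(1), of p a] decomp[OF that(3), of p a] that(2,4) p by simp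
    qed
    ultimately show "\<exists>!f. f \<in> (\<Pi>\<^sub>E M\<in>L ` S. M) \<and> x = (\<Oplus>M\<in>L ` S. f M)"
      by blast
  qed (use fin simple in auto)
qed

lemma semisimple_iff:
  assumes "finite S" and "\<phi> = (\<Prod>a\<in>S. [:- r a, 1:])"
  shows "semisimple_algebra R \<longleftrightarrow> inj_on r S"
  using semisimple[OF assms] not_semisimple[OF assms] unfolding inj_on_def by blast

end


section \<open>Quotient algebras over central scalars\<close>

lemma ring_type_algebra: "ring (type_algebra s :: ('k, 'a::ring_1) module)"
proof (intro ringI abelian_groupI Group.monoidI)
  fix x :: 'a
  show "\<exists>y\<in>carrier (type_algebra s). y \<oplus>\<^bsub>type_algebra s\<^esub> x = \<zero>\<^bsub>type_algebra s\<^esub>"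
    by (intro bexI[of _ "- x"]) (simp_all add: type_algebra_def)
qed (simp_all add: type_algebra_def algebra_simps)

text \<open>Adding the scalar field to the record leaves the ring operations of the factor ring
  unchanged, so the identity transports the ring axioms.\<close>

lemma ring_quot_algebra:
  assumes "ideal I A"
  shows "ring (quot_algebra A I)"
proof -
  have "id \<in> ring_iso (A Quot I) (quot_algebra A I)"
    by (rule ring_iso_memI) (auto simp: quot_algebra_def ring.defs)
  from ring.ring_iso_imp_img_ring[OF ideal.quotient_is_ring[OF assms] this] show ?thesis
    by (simp add: quot_algebra_def ring.defs)
qed

context central_quotient
begin

abbreviation "A \<equiv> type_algebra (\<lambda>c x. sc c * x)"
abbreviation "Q \<equiv> quot_algebra A I"

section \<open>The quotient map and the subalgebra generated by one element\<close>

definition proj where "proj x = I +>\<^bsub>A\<^esub> x"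

lemma ideal_I: "ideal I A"
proof -
  interpret A: ring A
    by (rule ring_type_algebra)
  have "\<ominus>\<^bsub>A\<^esub> x = - x" for x
    by (rule A.minus_equality) (simp_all add: type_algebra_def)
  then show ?thesis
    by (intro idealI[OF A.ring_axioms] A.add.subgroupI)
      (use I_0 in \<open>auto simp: type_algebra_def intro: I_add I_left I_right I_minus\<close>)
qed

sublocale Q: ring Q
  using ideal_I by (rule ring_quot_algebra)

lemma proj_eq_iff: "proj x = proj y \<longleftrightarrow> x - y \<in> I"
proof -
  have coset: "proj x = (\<lambda>i. i + x) ` I" for x
    by (auto simp: proj_def a_r_coset_def r_coset_def type_algebra_def)
  show ?thesis
  proof
    assume "proj x = proj y"
    then have "0 + x \<in> (\<lambda>i. i + y) ` I"
      unfolding coset using I_0 by blast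
    then show "x - y \<in> I"
      by auto
  next
    assume xy: "x - y \<in> I"
    have "i + x \<in> (\<lambda>i. i + y) ` I" "i + y \<in> (\<lambda>i. i + x) ` I" if "i \<in> I" for i
      using I_add[OF that xy] I_diff[OF that xy]
      by (auto intro: image_eqI[of _ _ "i + (x - y)"] image_eqI[of _ _ "i - (x - y)"])
    then show "proj x = proj y"
      unfolding coset by blast
  qed
qed

lemma proj_self: "x \<in> proj x"
  using I_0 by (auto simp: proj_def a_r_coset_def r_coset_def type_algebra_def intro!: bexI[of _ 0])

lemma proj_mem: "y \<in> proj x \<Longrightarrow> y - x \<in> I"
  by (auto simp: proj_def a_r_coset_def r_coset_def type_algebra_def)

lemma range_proj: "range proj = carrier Q"
  by (auto simp: quot_algebra_def ring.defs FactRing_def A_RCOSETS_def RCOSETS_def proj_def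
      a_r_coset_def type_algebra_def)

lemma proj_closed [simp]: "proj x \<in> carrier Q"
  using range_proj by blast

lemma proj_1: "proj 1 = \<one>\<^bsub>Q\<^esub>"
  by (simp add: quot_algebra_def ring.defs FactRing_def proj_def type_algebra_def)

lemma proj_add: "proj (x + y) = proj x \<oplus>\<^bsub>Q\<^esub> proj y"
  using ring_hom_add[OF ideal.rcos_ring_hom[OF ideal_I], of x y]
  by (simp add: quot_algebra_def ring.defs proj_def type_algebra_def)

lemma proj_mult: "proj (x * y) = proj x \<otimes>\<^bsub>Q\<^esub> proj y"
  using ring_hom_mult[OF ideal.rcos_ring_hom[OF ideal_I], of x y]
  by (simp add: quot_algebra_def ring.defs proj_def type_algebra_def)

text \<open>Scaling any representative gives the same coset, so the union over representatives in
  \<open>quot_algebra\<close> collapses to one coset.\<close>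

lemma proj_smult: "proj (sc c * x) = c \<odot>\<^bsub>Q\<^esub> proj x"
proof -
  have "proj (sc c * y) = proj (sc c * x)" if "y \<in> proj x" for y
    unfolding proj_eq_iff using I_left[OF proj_mem[OF that], of "sc c"] by (simp add: right_diff_distrib)
  then have "(\<Union>y\<in>proj x. proj (sc c * y)) = proj (sc c * x)"
    using proj_self by blast
  moreover have "c \<odot>\<^bsub>Q\<^esub> proj x = (\<Union>y\<in>proj x. proj (sc c * y))"
    by (simp add: quot_algebra_def ring.defs module.defs proj_def type_algebra_def)
  ultimately show ?thesis
    by simp
qed

lemma proj_0: "proj 0 = \<zero>\<^bsub>Q\<^esub>"
  using proj_add[of 0 0] Q.add.r_cancel_one' by simp

lemma proj_eq_0_iff: "proj x = \<zero>\<^bsub>Q\<^esub> \<longleftrightarrow> x \<in> I"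
  using proj_eq_iff[of x 0] by (simp add: proj_0)

lemma proj_minus: "proj (- x) = \<ominus>\<^bsub>Q\<^esub> proj x"
  using proj_add[of "- x" x] by (intro Q.minus_equality[symmetric]) (simp_all add: proj_0)

lemma proj_power: "proj (x ^ n) = proj x [^]\<^bsub>Q\<^esub> n"
  by (induction n) (simp_all add: proj_1 proj_mult power_Suc2 del: power_Suc)

lemma proj_sum: "finite S \<Longrightarrow> proj (sum f S) = (\<Oplus>\<^bsub>Q\<^esub>i\<in>S. proj (f i))"
  by (induction S rule: finite_induct) (simp_all add: proj_0 proj_add)

lemma eval_poly_proj: "eval_poly Q p (proj g) = proj (ev p g)"
  unfolding eval_poly_def ev_def by (simp add: proj_sum proj_smult proj_power)

text \<open>The values of polynomials at \<open>g\<close> form a unital subalgebra containing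
  \<open>g\<close>; conversely, Horner's scheme places each of them in every such
  subalgebra.\<close>

lemma carrier_generated_subalgebra:
  "carrier (generated_subalgebra Q {proj g}) = range (\<lambda>p. proj (ev p g))"
proof -
  let ?B = "range (\<lambda>p. proj (ev p g))"
  have "subring ?B Q"
  proof (rule Q.subringI)
    show "\<one>\<^bsub>Q\<^esub> \<in> ?B"
      by (rule range_eqI[of _ _ 1]) (simp add: ev_1 proj_1)
  next
    fix a
    assume "a \<in> ?B"
    then obtain p where "a = proj (ev p g)"
      by blast
    then show "\<ominus>\<^bsub>Q\<^esub> a \<in> ?B"
      using ev_diff[of 0 p g] by (intro range_eqI[of _ _ "- p"]) (simp add: ev_0 proj_minus)
  next
    fix a b
    assume "a \<in> ?B" "b \<in> ?B"
    then obtain p r where "a = proj (ev p g)" "b = proj (ev r g)"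
      by blast
    then have "a \<otimes>\<^bsub>Q\<^esub> b = proj (ev (p * r) g)" "a \<oplus>\<^bsub>Q\<^esub> b = proj (ev (p + r) g)"
      by (simp_all add: ev_mult ev_add proj_mult proj_add)
    then show "a \<otimes>\<^bsub>Q\<^esub> b \<in> ?B" "a \<oplus>\<^bsub>Q\<^esub> b \<in> ?B"
      by blast+
  qed auto
  moreover have "c \<odot>\<^bsub>Q\<^esub> a \<in> ?B" if "a \<in> ?B" for c a
  proof -
    from that obtain p where "a = proj (ev p g)"
      by blast
    then show ?thesis
      by (intro range_eqI[of _ _ "smult c p"]) (simp add: ev_smult proj_smult)
  qed
  moreover have "proj g \<in> ?B"
    by (rule range_eqI[of _ _ "monom 1 1"]) (simp add: ev_monom sc_1)
  ultimately have "unital_subalgebra ?B Q \<and> {proj g} \<subseteq> ?B"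
    unfolding unital_subalgebra_def by blast
  moreover have "proj (ev p g) \<in> B" if B: "unital_subalgebra B Q \<and> {proj g} \<subseteq> B" for B p
  proof (induction p)
    case 0
    show ?case
      using subringE(2)[of B Q] B by (simp add: unital_subalgebra_def ev_0 proj_0)
  next
    case (pCons a p)
    have "proj (sc a * 1) \<in> B"
      unfolding proj_smult proj_1 using subringE(3)[of B Q] B by (simp add: unital_subalgebra_def)
    moreover have "proj (g * ev p g) \<in> B"
      unfolding proj_mult using subringE(6)[of B Q] B pCons by (simp add: unital_subalgebra_def)
    ultimately show ?case
      using subringE(7)[of B Q] B by (simp add: unital_subalgebra_def ev_pCons proj_add)
  qed
  ultimately show ?thesis
    unfolding generated_subalgebra_def by auto
qed

text \<open>The remainder of \<open>p\<close> modulo \<phi> also sends \<open>g\<close> into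
  \<open>I\<close>, so minimality of the degree makes it zero.\<close>

lemma ev_mem_iff_dvd:
  assumes "ev \<phi> g \<in> I" and min: "\<And>r. r \<noteq> 0 \<Longrightarrow> ev r g \<in> I \<Longrightarrow> degree \<phi> \<le> degree r"
    and "\<phi> \<noteq> 0"
  shows "ev p g \<in> I \<longleftrightarrow> \<phi> dvd p"
proof
  assume p: "ev p g \<in> I"
  have "ev (p mod \<phi>) g = ev p g - ev (p div \<phi>) g * ev \<phi> g"
    by (simp add: minus_div_mult_eq_mod[symmetric] ev_diff ev_mult)
  then have "ev (p mod \<phi>) g \<in> I"
    using p assms(1) by (simp add: I_diff I_left)
  then have "p mod \<phi> = 0"
    using min[of "p mod \<phi>"] degree_mod_less[OF assms(3), of p] by linarith
  then show "\<phi> dvd p"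
    by (simp add: mod_eq_0_iff_dvd)
next
  assume "\<phi> dvd p"
  then show "ev p g \<in> I"
    using assms(1) by (auto simp: ev_mult I_right elim!: dvdE)
qed

lemma poly_quotient_generated:
  assumes "\<And>p. ev p g \<in> I \<longleftrightarrow> \<phi> dvd p"
  shows "poly_quotient (generated_subalgebra Q {proj g}) (\<lambda>p. proj (ev p g)) \<phi>"
proof -
  let ?G = "generated_subalgebra Q {proj g}"
  have G: "?G = Q\<lparr>carrier := carrier ?G\<rparr>"
    by (simp add: generated_subalgebra_def)
  have "\<Inter>{B. unital_subalgebra B Q \<and> {proj g} \<subseteq> B} = carrier ?G"
    by (simp add: generated_subalgebra_def)
  \<comment> \<open>The whole algebra belongs to the family being intersected, so the intersection
    is over a nonempty family and is a subring.\<close>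
  moreover have "unital_subalgebra (carrier Q) Q \<and> {proj g} \<subseteq> carrier Q"
  proof -
    have "c \<odot>\<^bsub>Q\<^esub> x \<in> carrier Q" if "x \<in> range proj" for c x
      using that by (auto simp: proj_smult[symmetric])
    then show ?thesis
      unfolding unital_subalgebra_def range_proj using Q.carrier_is_subring by simp
  qed
  ultimately have "subring (carrier ?G) Q"
    by (metis (mono_tags, lifting) Q.subring_Inter empty_iff mem_Collect_eq unital_subalgebra_def)
  then have "ring ?G"
    by (subst G) (rule Q.subring_is_ring)
  then show ?thesis
  proof (rule poly_quotient.intro, unfold_locales)
    show "range (\<lambda>p. proj (ev p g)) = carrier ?G"
      by (simp add: carrier_generated_subalgebra)
    show "proj (ev (smult c p) g) = c \<odot>\<^bsub>?G\<^esub> proj (ev p g)" for c p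
      by (simp add: generated_subalgebra_def ev_smult proj_smult)
  qed (simp_all add: generated_subalgebra_def ev_add ev_mult ev_1 proj_add proj_mult proj_1
      proj_eq_0_iff assms)
qed

end

text \<open>Constant polynomials serve as scalars and the multiples of \<phi> as ideal; the work is
  to identify that ideal with the generated one.\<close>

lemma poly_quotient_genideal:
  fixes \<phi> :: "'k::field poly"
  defines "J \<equiv> genideal poly_algebra {\<phi>}"
  shows "poly_quotient (quot_algebra poly_algebra J) (\<lambda>p. J +>\<^bsub>poly_algebra\<^esub> p) \<phi>"
proof -
  interpret central_quotient "\<lambda>c::'k. [:c:]" "{p. \<phi> dvd p}"
    by unfold_locales (auto simp: one_pCons mult.commute)
  have A: "poly_algebra = A"
    by (simp add: poly_algebra_def fun_eq_iff)
  interpret P: ring "poly_algebra :: ('k, 'k poly) module"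
    unfolding poly_algebra_def by (rule ring_type_algebra)
  have car: "carrier poly_algebra = UNIV"
    by (simp add: poly_algebra_def type_algebra_def)
  have J: "J = {p. \<phi> dvd p}"
  proof
    show "J \<subseteq> {p. \<phi> dvd p}"
      unfolding J_def A using ideal_I by (rule ring.genideal_minimal[OF ring_type_algebra]) simp
  next
    have "ideal J poly_algebra" "\<phi> \<in> J"
      unfolding J_def using P.genideal_ideal[of "{\<phi>}"] P.genideal_self'[of \<phi>] by (auto simp: car)
    then have "\<phi> * p \<in> J" for p
      using ideal.I_r_closed[of J poly_algebra \<phi> p] by (simp add: poly_algebra_def type_algebra_def)
    then show "{p. \<phi> dvd p} \<subseteq> J"
      by (auto elim!: dvdE)
  qed
  have h: "(\<lambda>p. J +>\<^bsub>poly_algebra\<^esub> p) = proj"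
    unfolding J A by (rule ext) (simp only: proj_def)
  have QQ: "quot_algebra poly_algebra J = Q"
    unfolding J A ..
  show ?thesis
    unfolding h QQ
  proof (rule poly_quotient.intro[OF Q.ring_axioms], unfold_locales)
    show "proj (smult c p) = c \<odot>\<^bsub>Q\<^esub> proj p" for c p
      using proj_smult[of c p] by simp
    show "proj p = \<zero>\<^bsub>Q\<^esub> \<longleftrightarrow> \<phi> dvd p" for p
      unfolding proj_eq_0_iff by simp
  qed (simp_all add: proj_add proj_mult proj_1 range_proj)
qed


section \<open>Baby Verma modules\<close>

lemma poly_mapping_additive_induct:
  fixes x :: "'w \<Rightarrow>\<^sub>0 'k::comm_monoid_add"
  assumes single: "\<And>w c. P (Poly_Mapping.single w c)" and add: "\<And>x y. P x \<Longrightarrow> P y \<Longrightarrow> P (x + y)"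
  shows "P x"
proof (induction x rule: update_induct)
  case const
  show ?case
    using single[of undefined 0] by simp
next
  case (update f w c)
  have "Poly_Mapping.update w c f = f + Poly_Mapping.single w c"
    using update by (intro poly_mapping_eqI) (auto simp: lookup_update lookup_add lookup_single in_keys_iff when_def)
  then show ?case
    using add update single by simp
qed

lemma central_scalars_free_const: "central_scalars (free_const :: 'k::field \<Rightarrow> ('k, 'g) free_alg)"
proof
  fix x :: "('k, 'g) free_alg" and c :: 'k
  show "x * free_const c = free_const c * x"
    by (induction x rule: poly_mapping_additive_induct)
      (auto simp: free_const_def mult_single mult.commute distrib_left distrib_right)
qed (auto simp: free_const_def single_add mult_single)

text \<open>Baby Verma modules with lowest weight \<open>1\<close>, repeated with period \<open>N\<close> so that
  indices need not be bounded.\<close>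

definition verma_coeff :: "'k::field \<Rightarrow> nat \<Rightarrow> 'k" where
  "verma_coeff q m = (((1 / q\<^sup>2) ^ m - 1) / (1 / q\<^sup>2 - 1) - ((q\<^sup>2) ^ m - 1) / (q\<^sup>2 - 1)) / (q - 1 / q)"

text \<open>Vectors are coordinate functions, so \<open>Gen_E\<close> reads the coordinate below
  \<open>j\<close> and \<open>Gen_F\<close> the one above. Each block of \<open>N\<close> indices is
  a submodule: \<open>Gen_E\<close> is cut off at multiples of \<open>N\<close>, where
  \<open>verma_coeff\<close> also vanishes.\<close>

fun verma :: "nat \<Rightarrow> 'k::field \<Rightarrow> uq_gen \<Rightarrow> (nat \<Rightarrow> 'k) \<Rightarrow> nat \<Rightarrow> 'k" where
  "verma N q Gen_K v j = (q\<^sup>2) ^ j * v j"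
| "verma N q Gen_E v j = (if N dvd j then 0 else v (j - 1))"
| "verma N q Gen_F v j = verma_coeff q (Suc j) * v (Suc j)"

lemma verma_linear:
  "verma N q g (\<lambda>j. v j + w j) = (\<lambda>j. verma N q g v j + verma N q g w j)"
  "verma N q g (\<lambda>j. c * v j) = (\<lambda>j. c * verma N q g v j)"
  by (cases g; auto simp: algebra_simps)+

text \<open>With \<open>foldr\<close> the rightmost letter acts first, so concatenation of words is
  composition of operators.\<close>

fun verma_word :: "nat \<Rightarrow> 'k::field \<Rightarrow> uq_gen free_monoid \<Rightarrow> (nat \<Rightarrow> 'k) \<Rightarrow> nat \<Rightarrow> 'k" where
  "verma_word N q (Word gs) = foldr (verma N q) gs"

lemma verma_word_linear:
  "verma_word N q u (\<lambda>j. v j + w j) = (\<lambda>j. verma_word N q u v j + verma_word N q u w j)"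
  "verma_word N q u (\<lambda>j. c * v j) = (\<lambda>j. c * verma_word N q u v j)"
proof -
  obtain gs where "u = Word gs"
    by (cases u)
  moreover have "foldr (verma N q) gs (\<lambda>j. v j + w j)
      = (\<lambda>j. foldr (verma N q) gs v j + foldr (verma N q) gs w j)"
    "foldr (verma N q) gs (\<lambda>j. c * v j) = (\<lambda>j. c * foldr (verma N q) gs v j)"
    by (induction gs) (simp_all add: verma_linear)
  ultimately show "verma_word N q u (\<lambda>j. v j + w j) = (\<lambda>j. verma_word N q u v j + verma_word N q u w j)"
    "verma_word N q u (\<lambda>j. c * v j) = (\<lambda>j. c * verma_word N q u v j)"
    by simp_all
qed

lemma verma_word_add: "verma_word N q (u + w) v = verma_word N q u (verma_word N q w v)"
  by (cases u; cases w) simp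

definition verma_act :: "nat \<Rightarrow> 'k::field \<Rightarrow> ('k, uq_gen) free_alg \<Rightarrow> (nat \<Rightarrow> 'k) \<Rightarrow> nat \<Rightarrow> 'k" where
  "verma_act N q x v j = (\<Sum>w\<in>Poly_Mapping.keys x. Poly_Mapping.lookup x w * verma_word N q w v j)"

lemma verma_act_superset:
  assumes "finite S" "Poly_Mapping.keys x \<subseteq> S"
  shows "verma_act N q x v j = (\<Sum>w\<in>S. Poly_Mapping.lookup x w * verma_word N q w v j)"
  unfolding verma_act_def by (rule sum.mono_neutral_left) (use assms in \<open>auto simp: in_keys_iff\<close>)

lemma verma_act_single: "verma_act N q (Poly_Mapping.single w c) v j = c * verma_word N q w v j"
  by (subst verma_act_superset[of "{w}"]) auto

lemma verma_act_add: "verma_act N q (x + y) v j = verma_act N q x v j + verma_act N q y v j"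
proof -
  let ?S = "Poly_Mapping.keys x \<union> Poly_Mapping.keys y"
  have "Poly_Mapping.keys (x + y) \<subseteq> ?S"
    by (rule keys_add)
  then show ?thesis
    by (simp add: verma_act_superset[of ?S] lookup_add distrib_right sum.distrib)
qed

lemma verma_act_linear:
  "verma_act N q x (\<lambda>j. v j + w j) = (\<lambda>j. verma_act N q x v j + verma_act N q x w j)"
  "verma_act N q x (\<lambda>j. c * v j) = (\<lambda>j. c * verma_act N q x v j)"
  by (auto simp: verma_act_def verma_word_linear sum.distrib sum_distrib_left algebra_simps)

text \<open>Both sides are additive in \<open>x\<close> and in \<open>y\<close>, which reduces the
  claim to single words.\<close>

lemma verma_act_mult: "verma_act N q (x * y) v = verma_act N q x (verma_act N q y v)"
proof
  fix j
  show "verma_act N q (x * y) v j = verma_act N q x (verma_act N q y v) j"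
  proof (induction x rule: poly_mapping_additive_induct)
    case (1 u c)
    show ?case
    proof (induction y rule: poly_mapping_additive_induct)
      case (1 w d)
      have "verma_act N q (Poly_Mapping.single w d) v = (\<lambda>j. d * verma_word N q w v j)"
        by (rule ext) (rule verma_act_single)
      then show ?case
        by (simp add: mult_single verma_act_single verma_word_add verma_word_linear)
    next
      case (2 y z)
      have "verma_act N q (y + z) v = (\<lambda>j. verma_act N q y v j + verma_act N q z v j)"
        by (rule ext) (rule verma_act_add)
      with 2 show ?case
        by (simp add: distrib_left verma_act_add verma_act_linear)
    qed
  next
    case (2 x y)
    then show ?case
      by (simp add: distrib_right verma_act_add)
  qed
qed

lemma verma_act_gen: "verma_act N q (free_gen g) v = verma N q g v"
  by (rule ext) (simp add: free_gen_def verma_act_single)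

lemma verma_act_const: "verma_act N q (free_const c) v = (\<lambda>j. c * v j)"
  by (rule ext) (simp add: free_const_def verma_act_single zero_free_monoid_def)

lemma verma_act_1: "verma_act N q 1 v = v"
  using verma_act_const[of N q 1 v] by (simp add: central_scalars.sc_1[OF central_scalars_free_const])

lemma verma_act_diff: "verma_act N q (x - y) v j = verma_act N q x v j - verma_act N q y v j"
  using verma_act_add[of N q "x - y" y v j] by simp

lemma verma_act_0: "verma_act N q 0 v j = 0"
  by (simp add: verma_act_def)

lemma verma_act_sum: "verma_act N q (sum f S) v j = (\<Sum>i\<in>S. verma_act N q (f i) v j)"
  by (induction S rule: infinite_finite_induct) (simp_all add: verma_act_0 verma_act_add)

text \<open>The annihilator of the module is a two-sided ideal, so for the defining ideal it
  suffices to check the relators.\<close>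

lemma central_quotient_verma: "central_quotient free_const {x. \<forall>v j. verma_act N q x v j = 0}"
proof -
  have zero: "verma_act N q x (\<lambda>_. 0) j = 0" for x j
    using fun_cong[OF verma_act_linear(2)[of N q x 0 "\<lambda>_. 0"], of j] by simp
  show ?thesis
  proof (intro central_quotient.intro central_scalars_free_const central_quotient_axioms.intro)
    fix a b r :: "('a, uq_gen) free_alg"
    assume a: "a \<in> {x. \<forall>v j. verma_act N q x v j = 0}"
    then have "verma_act N q a v = (\<lambda>_. 0)" for v
      by auto
    with a show "r * a \<in> {x. \<forall>v j. verma_act N q x v j = 0}"
      and "a * r \<in> {x. \<forall>v j. verma_act N q x v j = 0}"
      by (auto simp: verma_act_mult zero)
  qed (auto simp: verma_act_0 verma_act_add)
qed

section \<open>The defining relations on baby Verma modules\<close>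

lemma verma_act_K_power: "verma_act N q (free_gen Gen_K ^ n) v j = (q\<^sup>2) ^ (j * n) * v j"
  by (induction n arbitrary: j)
    (simp_all add: verma_act_1 verma_act_mult verma_act_gen power_add)

text \<open>Each application moves one index down inside the block of \<open>j\<close>; more than
  \<open>j mod N\<close> of them run into its lower end, where \<open>Gen_E\<close> gives
  zero.\<close>

lemma verma_act_E_power:
  assumes "0 < N" and "j mod N < n"
  shows "verma_act N q (free_gen Gen_E ^ n) v j = 0"
  using assms(2)
proof (induction n arbitrary: j)
  case (Suc n)
  have "(j - 1) mod N < n" if "\<not> N dvd j"
  proof -
    have "j = Suc (j - 1)"
      using that by (cases j) auto
    then have "j mod N = Suc ((j - 1) mod N)"
      using that by (metis dvd_eq_mod_eq_0 mod_Suc)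
    then show ?thesis
      using Suc.prems by simp
  qed
  then show ?case
    using Suc.IH[of "j - 1"] by (simp add: verma_act_mult verma_act_gen)
qed simp

lemma verma_coeff_eq_0:
  assumes "primitive_root_of_unity N (q\<^sup>2)" and "N dvd m"
  shows "verma_coeff q m = 0"
proof -
  obtain k where k: "m = N * k"
    using assms(2) by (elim dvdE)
  have "(q\<^sup>2) ^ m = 1"
    unfolding k power_mult using assms(1) by (simp add: primitive_root_of_unity_def)
  then show ?thesis
    by (simp add: verma_coeff_def power_one_over)
qed

text \<open>The mirror image: the indices run up to the end of the block, where
  \<open>verma_coeff\<close> vanishes.\<close>

lemma verma_act_F_power:
  assumes "0 < N" and "primitive_root_of_unity N (q\<^sup>2)" and "N \<le> j mod N + n"
  shows "verma_act N q (free_gen Gen_F ^ n) v j = 0"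
  using assms(3)
proof (induction n arbitrary: j)
  case 0
  then show ?case
    using mod_less_divisor[OF assms(1), of j] by simp
next
  case (Suc n)
  show ?case
  proof (cases "N dvd Suc j")
    case True
    then show ?thesis
      by (simp add: verma_act_mult verma_act_gen verma_coeff_eq_0[OF assms(2)])
  next
    case False
    then have "Suc j mod N = Suc (j mod N)"
      by (metis dvd_eq_mod_eq_0 mod_Suc)
    then show ?thesis
      using Suc by (simp add: verma_act_mult verma_act_gen)
  qed
qed

text \<open>The recurrence demanded by the commutator of \<open>Gen_E\<close> and
  \<open>Gen_F\<close>; \<open>verma_coeff\<close> is its solution as a difference of two geometric
  sums.\<close>

lemma verma_coeff_diff:
  assumes "q \<noteq> 0" and "q\<^sup>2 \<noteq> 1"
  shows "verma_coeff q j - verma_coeff q (Suc j) = ((q\<^sup>2) ^ j - 1 / (q\<^sup>2) ^ j) / (q - 1 / q)"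
proof -
  have geom: "(a ^ Suc j - 1) / (a - 1) - (a ^ j - 1) / (a - 1) = a ^ j" if "a \<noteq> 1" for a :: 'a
    using that by (simp add: diff_divide_distrib[symmetric]) (simp add: field_simps)
  have "1 / q\<^sup>2 \<noteq> 1"
    using assms by (simp add: field_simps)
  have arrange: "(a - b) / d - (a' - b') / d = ((b' - b) - (a' - a)) / d" for a b a' b' d :: 'a
    by (simp add: diff_divide_distrib)
  have "verma_coeff q j - verma_coeff q (Suc j) =
      ((((q\<^sup>2) ^ Suc j - 1) / (q\<^sup>2 - 1) - ((q\<^sup>2) ^ j - 1) / (q\<^sup>2 - 1)) -
       (((1 / q\<^sup>2) ^ Suc j - 1) / (1 / q\<^sup>2 - 1) - ((1 / q\<^sup>2) ^ j - 1) / (1 / q\<^sup>2 - 1))) / (q - 1 / q)"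
    unfolding verma_coeff_def by (rule arrange)
  then show ?thesis
    unfolding geom[OF assms(2)] geom[OF \<open>1 / q\<^sup>2 \<noteq> 1\<close>] unfolding power_one_over .
qed

lemma uq_relators_verma:
  assumes N: "0 < N" and q: "primitive_root_of_unity N (q\<^sup>2)" and q2: "q\<^sup>2 \<noteq> 1"
    and x: "x \<in> uq_relators N q"
  shows "verma_act N q x v j = 0"
proof -
  have q0: "q \<noteq> 0"
    using primitive_root_nonzero[OF q N] by auto
  \<comment> \<open>The second equation says that \<open>K ^ (N - 1)\<close> acts as the inverse of
    \<open>K\<close>.\<close>
  have qN: "(q\<^sup>2) ^ (j * N) = 1" "(q\<^sup>2) ^ (j * (N - 1)) = 1 / (q\<^sup>2) ^ j"
  proof -
    show 1: "(q\<^sup>2) ^ (j * N) = 1"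
      using q by (metis primitive_root_of_unity_def power_mult mult.commute power_one)
    have "(q\<^sup>2) ^ (j * (N - 1)) * (q\<^sup>2) ^ j = (q\<^sup>2) ^ (j * N)"
      using N by (simp add: power_add[symmetric] algebra_simps)
    then show "(q\<^sup>2) ^ (j * (N - 1)) = 1 / (q\<^sup>2) ^ j"
      unfolding 1 using q0 by (simp add: field_simps)
  qed
  note act = verma_act_diff verma_act_mult verma_act_const verma_act_gen verma_act_K_power verma_act_1
  consider "x = free_gen Gen_K ^ N - 1"
    | "x = free_gen Gen_K * free_gen Gen_E - free_const (q\<^sup>2) * (free_gen Gen_E * free_gen Gen_K)"
    | "x = free_gen Gen_K * free_gen Gen_F - free_const (1 / q\<^sup>2) * (free_gen Gen_F * free_gen Gen_K)"
    | "x = free_gen Gen_E ^ N"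
    | "x = free_gen Gen_F ^ N"
    | "x = free_gen Gen_E * free_gen Gen_F - free_gen Gen_F * free_gen Gen_E
        - free_const (1 / (q - 1 / q)) * (free_gen Gen_K - free_gen Gen_K ^ (N - 1))"
    using x unfolding uq_relators_def Let_def by blast
  then show ?thesis
  proof cases
    case 1
    then show ?thesis
      by (simp add: act qN)
  next
    case 2
    then show ?thesis
      by (cases j) (auto simp: act)
  next
    case 3
    then show ?thesis
      using q0 by (simp add: act)
  next
    case 4
    then show ?thesis
      using N by (simp add: verma_act_E_power)
  next
    case 5
    then show ?thesis
      using N q by (simp add: verma_act_F_power)
  next
    case 6
    \<comment> \<open>At a multiple of \<open>N\<close> the left side is cut off, and the right side
      vanishes with \<open>verma_coeff\<close>, so no case distinction survives.\<close>
    have EF: "verma_act N q (free_gen Gen_E * free_gen Gen_F) v j = verma_coeff q j * v j"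
      using verma_coeff_eq_0[OF q, of j] by (cases j) (auto simp: act)
    have FE: "verma_act N q (free_gen Gen_F * free_gen Gen_E) v j = verma_coeff q (Suc j) * v j"
      using verma_coeff_eq_0[OF q, of "Suc j"] by (auto simp: act)
    have "verma_act N q x v j = (verma_coeff q j - verma_coeff q (Suc j)) * v j
        - 1 / (q - 1 / q) * (verma N q Gen_K v j - 1 / (q\<^sup>2) ^ j * v j)"
      unfolding 6 verma_act_diff EF FE
      by (simp only: verma_act_mult verma_act_const verma_act_diff verma_act_gen verma_act_K_power qN)
        (simp add: algebra_simps)
    also have "\<dots> = 0"
      unfolding verma_coeff_diff[OF q0 q2] by (simp add: algebra_simps diff_divide_distrib)
    finally show ?thesis .
  qed
qed


section \<open>The element \<open>u\<close> of the small quantum group\<close>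

text \<open>Only the \<open>Gen_E\<close> term raises the index, by one and with coefficient
  \<open>1\<close>. Hence the \<open>n\<close>-th power sends the lowest vector to something with
  top index \<open>n\<close> and coefficient \<open>1\<close> there, as long as no block boundary is
  met.\<close>

lemma verma_act_u_power:
  fixes a b :: "'k::field"
  defines "g \<equiv> free_gen Gen_E + free_const a * (free_gen Gen_K * free_gen Gen_F) + free_const b * free_gen Gen_K"
    and "v \<equiv> (\<lambda>j. if j = 0 then 1 else 0)"
  shows "n < j \<Longrightarrow> verma_act N q (g ^ n) v j = 0"
    and "n < N \<Longrightarrow> verma_act N q (g ^ n) v n = 1"
proof -
  have g: "verma_act N q g w j = (if N dvd j then 0 else w (j - 1))
      + a * ((q\<^sup>2) ^ j * (verma_coeff q (Suc j) * w (Suc j))) + b * ((q\<^sup>2) ^ j * w j)" for w j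
    by (simp add: g_def verma_act_add verma_act_mult verma_act_const verma_act_gen)
  show zero: "n < j \<Longrightarrow> verma_act N q (g ^ n) v j = 0" for n j
  proof (induction n arbitrary: j)
    case (Suc n)
    then show ?case
      using Suc.IH[of "j - 1"] by (simp add: verma_act_mult g)
  qed (simp add: verma_act_1 v_def)
  show "n < N \<Longrightarrow> verma_act N q (g ^ n) v n = 1"
  proof (induction n)
    case (Suc n)
    then have "\<not> N dvd Suc n"
      by (auto dest: dvd_imp_le)
    then show ?case
      using Suc by (simp add: verma_act_mult g zero)
  qed (simp add: verma_act_1 v_def)
qed

locale small_quantum_group =
  fixes N :: nat and q :: "'k::{alg_closed_field, field_char_0}"
  assumes N: "N > 1" "odd N" and prim: "primitive_root_of_unity N q"
begin

abbreviation "E \<equiv> free_gen Gen_E :: ('k, uq_gen) free_alg"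
abbreviation "F \<equiv> free_gen Gen_F :: ('k, uq_gen) free_alg"
abbreviation "K \<equiv> free_gen Gen_K :: ('k, uq_gen) free_alg"

lemma q0: "q \<noteq> 0"
  using prim N by (intro primitive_root_nonzero) auto

lemma prim2: "primitive_root_of_unity N (q\<^sup>2)"
  using prim N(2) by (rule primitive_root_square)

lemma q2: "q\<^sup>2 \<noteq> 1"
  using prim2 N(1) unfolding primitive_root_of_unity_def by (metis power_one_right zero_less_one)

lemma q_diff: "q - 1 / q \<noteq> 0"
  using q0 q2 by (simp add: field_simps power2_eq_square)

lemma ideal_uq: "ideal (uq_ideal N q) free_algebra" "uq_relators N q \<subseteq> uq_ideal N q"
proof -
  interpret ring "free_algebra :: ('k, ('k, uq_gen) free_alg) module"
    unfolding free_algebra_def by (rule ring_type_algebra)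
  have "S \<subseteq> carrier free_algebra" for S :: "('k, uq_gen) free_alg set"
    by (simp add: free_algebra_def type_algebra_def)
  then show "ideal (uq_ideal N q) free_algebra" "uq_relators N q \<subseteq> uq_ideal N q"
    unfolding uq_ideal_def by (rule genideal_ideal, rule genideal_self)
qed

sublocale central_quotient "free_const :: 'k \<Rightarrow> ('k, uq_gen) free_alg" "uq_ideal N q"
proof (intro central_quotient.intro central_scalars_free_const central_quotient_axioms.intro)
  interpret ideal "uq_ideal N q" free_algebra
    by (rule ideal_uq)
  show "0 \<in> uq_ideal N q"
    using additive_subgroup.zero_closed[OF additive_subgroup_axioms]
    by (simp add: free_algebra_def type_algebra_def del: zero_closed)
  show "a + b \<in> uq_ideal N q" if "a \<in> uq_ideal N q" "b \<in> uq_ideal N q" for a b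
    using additive_subgroup.a_closed[OF additive_subgroup_axioms that] by (simp add: free_algebra_def type_algebra_def)
  show "r * a \<in> uq_ideal N q" "a * r \<in> uq_ideal N q" if "a \<in> uq_ideal N q" for a r
    using I_l_closed[OF that, of r] I_r_closed[OF that, of r]
    by (simp_all add: free_algebra_def type_algebra_def)
qed

lemma uq_ideal_verma: "x \<in> uq_ideal N q \<Longrightarrow> verma_act N q x v j = 0"
proof -
  let ?J = "{x. \<forall>v j. verma_act N q x v j = 0}"
  interpret J: central_quotient free_const ?J
    by (rule central_quotient_verma)
  have "uq_relators N q \<subseteq> ?J"
    using uq_relators_verma[OF _ prim2 q2] N(1) by auto
  then have "uq_ideal N q \<subseteq> ?J"
    unfolding uq_ideal_def free_algebra_def
    by (rule ring.genideal_minimal[OF ring_type_algebra J.ideal_I])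
  then show "x \<in> uq_ideal N q \<Longrightarrow> verma_act N q x v j = 0"
    by blast
qed

section \<open>Oscillator relation and \<open>N\<close>-th powers\<close>

lemma relations:
  "K ^ N - 1 \<in> uq_ideal N q"
  "K * E - free_const (q\<^sup>2) * (E * K) \<in> uq_ideal N q"
  "K * F - free_const (1 / q\<^sup>2) * (F * K) \<in> uq_ideal N q"
  "E ^ N \<in> uq_ideal N q"
  "F ^ N \<in> uq_ideal N q"
  "E * F - F * E - free_const (1 / (q - 1 / q)) * (K - K ^ (N - 1)) \<in> uq_ideal N q"
  using ideal_uq(2) unfolding uq_relators_def Let_def by auto

lemma FK: "F * K - free_const (q\<^sup>2) * (K * F) \<in> uq_ideal N q"
proof -
  have "F * K - free_const (q\<^sup>2) * (K * F) =
      - (free_const (q\<^sup>2) * (K * F - free_const (1 / q\<^sup>2) * (F * K)))"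
    using q0 by (simp add: right_diff_distrib mult.assoc[symmetric] sc_mult[symmetric] sc_1)
  then show ?thesis
    using relations(3) by (simp add: I_minus I_left)
qed

text \<open>Moves \<open>E\<close> to the left of \<open>K * F\<close>: first the commutator of
  \<open>E\<close> and \<open>F\<close>, then the weight relation of \<open>K\<close> and
  \<open>E\<close>.\<close>

lemma KFE: "K * F * E - free_const (q\<^sup>2) * (E * K * F) + free_const (1 / (q - 1 / q)) * (K\<^sup>2 - K ^ N) \<in> uq_ideal N q"
proof -
  let ?d = "free_const (1 / (q - 1 / q)) :: ('k, uq_gen) free_alg"
  have "K ^ N = K * K ^ (N - 1)"
    using N(1) by (simp add: power_eq_if)
  then have "K * F * E - free_const (q\<^sup>2) * (E * K * F) + ?d * (K\<^sup>2 - K ^ N) =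
      (K * E - free_const (q\<^sup>2) * (E * K)) * F - K * (E * F - F * E - ?d * (K - K ^ (N - 1)))"
    by (simp add: algebra_simps power2_eq_square sc_left_commute[of K])
  then show ?thesis
    using relations(2,6) by (simp add: I_diff I_left I_right)
qed

lemma oscillator_relation:
  fixes x y a :: 'k
  defines "P \<equiv> E + free_const x * K"
    and "R \<equiv> free_const (a * (q - 1 / q)) * (K * F) + free_const y * K"
  assumes xy: "x * y * (1 - q\<^sup>2) = a"
  shows "R * P - free_const (q\<^sup>2) * (P * R) - free_const a \<in> uq_ideal N q"
proof -
  let ?k = "a * (q - 1 / q)"
  \<comment> \<open>The combination is the expansion of \<open>R * P - t * P * R\<close> sorted by
    relation, \<open>t\<close> being the square of \<open>q\<close>. The \<open>K * K\<close> terms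
    cancel because \<open>x * y * (1 - t) = a\<close>, and \<open>K ^ N\<close> leaves the constant
    \<open>a\<close>.\<close>
  have "free_const ?k * (K * F * E - free_const (q\<^sup>2) * (E * K * F) + free_const (1 / (q - 1 / q)) * (K\<^sup>2 - K ^ N))
      + free_const (?k * x) * (K * (F * K - free_const (q\<^sup>2) * (K * F)))
      + free_const y * (K * E - free_const (q\<^sup>2) * (E * K))
      + free_const a * (K ^ N - 1) \<in> uq_ideal N q"
    by (intro I_add I_left KFE FK relations)
  also have "free_const ?k * (K * F * E - free_const (q\<^sup>2) * (E * K * F) + free_const (1 / (q - 1 / q)) * (K\<^sup>2 - K ^ N))
      + free_const (?k * x) * (K * (F * K - free_const (q\<^sup>2) * (K * F)))
      + free_const y * (K * E - free_const (q\<^sup>2) * (E * K))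
      + free_const a * (K ^ N - 1) = R * P - free_const (q\<^sup>2) * (P * R) - free_const a"
  proof -
    have comm: "z * free_const c = free_const c * z" "z * (free_const c * w) = free_const c * (z * w)"
      if "z \<in> {E, F, K}" for z w :: "('k, uq_gen) free_alg" and c
      by (rule sc_commute, rule sc_left_commute)
    have fold: "free_const c * free_const d = (free_const (c * d) :: ('k, uq_gen) free_alg)"
      "free_const c * (free_const d * w) = free_const (c * d) * w" for c d and w :: "('k, uq_gen) free_alg"
      by (simp_all only: sc_mult mult.assoc)
    define k d where "k = ?k" and "d = 1 / (q - 1 / q)"
    have k: "k * d = a"
      using q_diff by (simp add: k_def d_def)
    have "free_const (y * x) * (K * K) - free_const (q\<^sup>2 * (x * y)) * (K * K) = free_const a * (K * K)"
      unfolding left_diff_distrib[symmetric] sc_diff[symmetric] by (simp add: xy[symmetric] algebra_simps)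
    then have K: "free_const (y * x) * (K * K) = free_const a * (K * K) + free_const (q\<^sup>2 * (x * y)) * (K * K)"
      by (simp add: diff_eq_eq)
    have s: "q\<^sup>2 * (x * k) = k * x * q\<^sup>2" "q\<^sup>2 * k = k * q\<^sup>2" "q\<^sup>2 * y = y * q\<^sup>2"
      by (simp_all only: ac_simps)
    show ?thesis
      unfolding P_def R_def power2_eq_square[of K] k_def[symmetric] d_def[symmetric]
      by (simp only: distrib_left distrib_right left_diff_distrib right_diff_distrib mult.assoc
          comm insert_iff simp_thms fold k K s mult_1_right) (simp add: algebra_simps)
  qed
  finally show ?thesis .
qed

lemma sc_mult_power: "(free_const c * z) ^ n = free_const (c ^ n) * z ^ n"
  for z :: "('k, uq_gen) free_alg"
  by (induction n) (simp_all add: sc_1 sc_mult mult.assoc sc_left_commute[of z])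

text \<open>All factors \<open>F\<close> can be moved to the left past the \<open>K\<close>, at the
  price of an unspecified right factor \<open>r\<close>; then \<open>F ^ N\<close> lies in the
  ideal.\<close>

lemma KF_power: "(K * F) ^ N \<in> uq_ideal N q"
proof -
  have "\<exists>r. (K * F) ^ n - F ^ n * r \<in> uq_ideal N q" for n
  proof (induction n)
    case 0
    show ?case
      by (rule exI[of _ 1]) (simp add: I_0)
  next
    case (Suc n)
    then obtain r where r: "(K * F) ^ n - F ^ n * r \<in> uq_ideal N q"
      by blast
    let ?c = "free_const ((1 / q\<^sup>2) ^ Suc n)"
    have "K * F ^ Suc n - ?c * (F ^ Suc n * K) \<in> uq_ideal N q"
      using qcommute_power[of K F "1 / q\<^sup>2" 0 n] relations(3) by (simp add: sc_0)
    then have "K * F * ((K * F) ^ n - F ^ n * r) + (K * F ^ Suc n - ?c * (F ^ Suc n * K)) * r \<in> uq_ideal N q"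
      using r by (intro I_add I_left I_right)
    also have "K * F * ((K * F) ^ n - F ^ n * r) + (K * F ^ Suc n - ?c * (F ^ Suc n * K)) * r
        = (K * F) ^ Suc n - F ^ Suc n * (?c * (K * r))"
      unfolding sc_left_commute[of "F ^ Suc n"] by (simp add: algebra_simps)
    finally show ?case
      by blast
  qed
  then obtain r where "(K * F) ^ N - F ^ N * r \<in> uq_ideal N q"
    by blast
  from I_add[OF this I_right[OF relations(5)], of r] show ?thesis
    by simp
qed

text \<open>The summands \<open>E\<close> and \<open>x K\<close> commute up to the square of
  \<open>q\<close>, so the binomial theorem leaves \<open>E ^ N\<close> and
  \<open>x ^ N K ^ N\<close>.\<close>

lemma P_power: "(E + free_const x * K) ^ N - free_const (x ^ N) \<in> uq_ideal N q"
proof -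
  have "free_const x * K * E - free_const (q\<^sup>2) * (E * (free_const x * K))
      = free_const x * (K * E - free_const (q\<^sup>2) * (E * K))"
    by (simp add: right_diff_distrib mult.assoc sc_left_commute[of E] sc_left_commute[of "free_const (q\<^sup>2)"])
  then have "(E + free_const x * K) ^ N - (E ^ N + (free_const x * K) ^ N) \<in> uq_ideal N q"
    using N prim2 relations(2) by (intro qbinomial_root_of_unity) (auto intro: I_left)
  moreover have "E ^ N + free_const (x ^ N) * (K ^ N - 1) \<in> uq_ideal N q"
    by (intro I_add I_left relations)
  ultimately show ?thesis
    using I_add by (fastforce simp: sc_mult_power right_diff_distrib)
qed

text \<open>As for \<open>P_power\<close>, but here \<open>y K\<close> is the left factor in the
  commutation rule, which explains the exchanged summands in the proof.\<close>

lemma Q_power: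
  "(free_const c * (K * F) + free_const y * K) ^ N - free_const (y ^ N) \<in> uq_ideal N q"
proof -
  have "free_const c * (K * F) * (free_const y * K) - free_const (q\<^sup>2) * (free_const y * K * (free_const c * (K * F)))
      = free_const (c * y) * (K * (F * K - free_const (q\<^sup>2) * (K * F)))"
    unfolding mult.assoc sc_left_commute[of K] sc_left_commute[of F] right_diff_distrib
    by (simp add: mult.assoc[symmetric] sc_mult[symmetric] mult.commute mult.left_commute)
  then have "(free_const y * K + free_const c * (K * F)) ^ N
      - ((free_const y * K) ^ N + (free_const c * (K * F)) ^ N) \<in> uq_ideal N q"
    using N prim2 FK by (intro qbinomial_root_of_unity) (auto intro!: I_left)
  moreover have "free_const (y ^ N) * (K ^ N - 1) + free_const (c ^ N) * (K * F) ^ N \<in> uq_ideal N q"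
    by (intro I_add I_left relations KF_power)
  ultimately have "(free_const y * K + free_const c * (K * F)) ^ N
      - ((free_const y * K) ^ N + (free_const c * (K * F)) ^ N)
      + (free_const (y ^ N) * (K ^ N - 1) + free_const (c ^ N) * (K * F) ^ N) \<in> uq_ideal N q"
    by (rule I_add)
  then show ?thesis
    by (simp add: sc_mult_power right_diff_distrib add.commute)
qed

definition u :: "'k \<Rightarrow> 'k \<Rightarrow> ('k, uq_gen) free_alg" where
  "u \<alpha> \<beta> = E + free_const (\<alpha> * (q - 1 / q)) * (K * F) + free_const \<beta> * K"

lemma uq_u: "uq_u N q \<alpha> \<beta> = proj (u \<alpha> \<beta>)"
proof -
  have fold: "uq_sl2 N q = Q" "uq_elem N q g = proj (free_gen g)" for g
    by (simp_all add: uq_sl2_def uq_elem_def free_algebra_def proj_def)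
  show ?thesis
    unfolding uq_u_def uq_Ftilde_def fold u_def
    by (simp only: proj_mult[symmetric] proj_smult[symmetric] proj_add[symmetric] sc_mult mult.assoc)
qed

lemma obtain_xy:
  obtains x y where "x + y = \<beta>" "x * y = \<alpha> / (1 - q\<^sup>2)"
proof -
  have "degree [:\<alpha> / (1 - q\<^sup>2), - \<beta>, 1:] > 0"
    by simp
  then obtain x where "poly [:\<alpha> / (1 - q\<^sup>2), - \<beta>, 1:] x = 0"
    using alg_closed_imp_poly_has_root by blast
  then show thesis
    by (intro that[of x "\<beta> - x"]) (simp_all add: algebra_simps eq_neg_iff_add_eq_0)
qed

lemma ev_phi: "ev (phi_poly N q \<alpha> \<beta>) (u \<alpha> \<beta>) \<in> uq_ideal N q"
proof -
  obtain x y where xy: "x + y = \<beta>" "x * y = \<alpha> / (1 - q\<^sup>2)"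
    by (rule obtain_xy)
  define P where "P = E + free_const x * K"
  define R where "R = free_const (\<alpha> * (q - 1 / q)) * (K * F) + free_const y * K"
  have u: "u \<alpha> \<beta> = P + R"
    by (simp add: u_def P_def R_def xy(1)[symmetric] sc_add algebra_simps)
  have a: "x * y * (1 - q\<^sup>2) = \<alpha>"
    using xy(2) q2 by simp
  have phi: "phi_poly N q \<alpha> \<beta> = qhermite (q\<^sup>2) (x * y) N - [:x ^ N + y ^ N:]"
    using phi_poly_factorization[OF prim N(2) q2 xy] qhermite_diff_const[OF prim2, of x y] N(1) by simp
  have "R * P - free_const (q\<^sup>2) * (P * R) - free_const (x * y * (1 - q\<^sup>2)) \<in> uq_ideal N q"
    unfolding a P_def R_def by (rule oscillator_relation) (rule a)
  then have "ev (qhermite (q\<^sup>2) (x * y) N) (P + R) - (P ^ N + R ^ N) \<in> uq_ideal N q"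
    using N prim2 by (intro ev_qhermite_root_of_unity) auto
  moreover have "(P ^ N - free_const (x ^ N)) + (R ^ N - free_const (y ^ N)) \<in> uq_ideal N q"
    unfolding P_def R_def by (intro I_add P_power Q_power)
  ultimately have "ev (qhermite (q\<^sup>2) (x * y) N) (P + R) - (P ^ N + R ^ N)
      + ((P ^ N - free_const (x ^ N)) + (R ^ N - free_const (y ^ N))) \<in> uq_ideal N q"
    by (rule I_add)
  then show ?thesis
    unfolding u phi ev_diff by (simp add: ev_pCons ev_0 sc_add algebra_simps)
qed

lemma degree_phi: "degree (phi_poly N q \<alpha> \<beta>) = N" "lead_coeff (phi_poly N q \<alpha> \<beta>) = 1"
proof -
  obtain x y where xy: "x + y = \<beta>" "x * y = \<alpha> / (1 - q\<^sup>2)"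
    by (rule obtain_xy)
  show "degree (phi_poly N q \<alpha> \<beta>) = N" "lead_coeff (phi_poly N q \<alpha> \<beta>) = 1"
    unfolding phi_poly_factorization[OF prim N(2) q2 xy] lead_coeff_prod_linear
    by (simp_all only: degree_prod_linear card_lessThan)
qed

text \<open>Applied to the lowest vector, the value of \<open>r\<close> at
  \<open>u \<alpha> \<beta>\<close> has the leading coefficient of \<open>r\<close> as its
  coordinate of index \<open>degree r\<close>, provided this index is below
  \<open>N\<close>.\<close>

lemma degree_ge:
  assumes "r \<noteq> 0" and "ev r (u \<alpha> \<beta>) \<in> uq_ideal N q"
  shows "N \<le> degree r"
proof (rule ccontr)
  assume d: "\<not> N \<le> degree r"
  let ?v = "\<lambda>j::nat. if j = 0 then 1 else 0 :: 'k"
  note pow = verma_act_u_power[where a = "\<alpha> * (q - 1 / q)" and b = \<beta>, folded u_def]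
  have "0 = verma_act N q (ev r (u \<alpha> \<beta>)) ?v (degree r)"
    using uq_ideal_verma[OF assms(2)] by simp
  also have "\<dots> = (\<Sum>i\<le>degree r. coeff r i * verma_act N q (u \<alpha> \<beta> ^ i) ?v (degree r))"
    by (simp only: ev_def verma_act_sum verma_act_mult verma_act_const)
  also have "\<dots> = (\<Sum>i\<in>{degree r}. coeff r i * verma_act N q (u \<alpha> \<beta> ^ i) ?v (degree r))"
    by (rule sum.mono_neutral_right) (auto simp: pow)
  also have "\<dots> = lead_coeff r"
    using d pow(2)[of "degree r" N q] by simp
  finally show False
    using assms(1) by simp
qed

lemma ev_u_mem_iff: "ev p (u \<alpha> \<beta>) \<in> uq_ideal N q \<longleftrightarrow> phi_poly N q \<alpha> \<beta> dvd p"
proof (rule ev_mem_iff_dvd[OF ev_phi])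
  show "phi_poly N q \<alpha> \<beta> \<noteq> 0"
    using degree_phi(2)[of \<alpha> \<beta>] by auto
qed (simp add: degree_phi(1) degree_ge)

lemma minimal_poly_iso_semisimple:
  "is_minimal_poly (uq_sl2 N q) (uq_u N q \<alpha> \<beta>) (phi_poly N q \<alpha> \<beta>)"
  "algebra_isomorphic (uq_A N q \<alpha> \<beta>)
      (quot_algebra poly_algebra (genideal poly_algebra {phi_poly N q \<alpha> \<beta>}))"
  "semisimple_algebra (uq_A N q \<alpha> \<beta>) \<longleftrightarrow> D_total N q \<alpha> \<beta> \<noteq> 0"
proof -
  let ?\<phi> = "phi_poly N q \<alpha> \<beta>"
  have fold: "uq_sl2 N q = Q"
    by (simp add: uq_sl2_def free_algebra_def)
  show "is_minimal_poly (uq_sl2 N q) (uq_u N q \<alpha> \<beta>) ?\<phi>"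
    unfolding is_minimal_poly_def uq_u fold eval_poly_proj proj_eq_0_iff
    using ev_phi degree_ge degree_phi by auto
  have PQ: "poly_quotient (uq_A N q \<alpha> \<beta>) (\<lambda>p. proj (ev p (u \<alpha> \<beta>))) ?\<phi>"
    unfolding uq_A_def uq_u fold by (rule poly_quotient_generated) (rule ev_u_mem_iff)
  show "algebra_isomorphic (uq_A N q \<alpha> \<beta>) (quot_algebra poly_algebra (genideal poly_algebra {?\<phi>}))"
    using PQ poly_quotient_genideal by (rule poly_quotient.isomorphic)
  obtain x y where xy: "x + y = \<beta>" "x * y = \<alpha> / (1 - q\<^sup>2)"
    by (rule obtain_xy)
  \<comment> \<open>An odd number above \<open>1\<close> is at least \<open>3\<close>, as the
    collision criterion for the roots requires.\<close>
  have "N > 2"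
    using N by (metis even_numeral less_2_cases_iff linorder_neqE_nat less_one not_less_iff_gr_or_eq)
  have "semisimple_algebra (uq_A N q \<alpha> \<beta>)
      \<longleftrightarrow> inj_on (\<lambda>k. x * (q\<^sup>2) ^ k + y / (q\<^sup>2) ^ k) {..<N}"
    using poly_quotient.semisimple_iff[OF PQ finite_lessThan phi_poly_factorization[OF prim N(2) q2 xy]] .
  also have "\<dots> \<longleftrightarrow> D_total N q \<alpha> \<beta> \<noteq> 0"
    using roots_inj_on_iff[OF prim2 \<open>N > 2\<close>] D_total_eq_0_iff[OF prim N(2,1) q2 xy] by simp
  finally show "semisimple_algebra (uq_A N q \<alpha> \<beta>) \<longleftrightarrow> D_total N q \<alpha> \<beta> \<noteq> 0" .
qed

end

theorem theorem4p10:
  fixes q \<alpha> \<beta> :: "'k::{alg_closed_field, field_char_0}" and N :: nat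
  assumes "N > 1" and "odd N" and "primitive_root_of_unity N q"
  shows "is_minimal_poly (uq_sl2 N q) (uq_u N q \<alpha> \<beta>) (phi_poly N q \<alpha> \<beta>) \<and>
    algebra_isomorphic (uq_A N q \<alpha> \<beta>)
      (quot_algebra poly_algebra (genideal poly_algebra {phi_poly N q \<alpha> \<beta>})) \<and>
    (semisimple_algebra (uq_A N q \<alpha> \<beta>) \<longleftrightarrow> D_total N q \<alpha> \<beta> \<noteq> 0)"
proof -
  interpret small_quantum_group N q
    using assms by unfold_locales
  show ?thesis
    using minimal_poly_iso_semisimple by blast
qed

end
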